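(* For every $r\in(2,\infty)$ and $q\in\{0,1\}$, $$\sup_{n\geqslant 1}\ \sup_{f\in\mathbb C^{\mathbb I^n}\setminus\{0\}}\frac{\big\|V_r(S_kf:k\in(2\mathbb Z+q)\cap\{0,1,\dots,n\})\big\|_{\ell^2(\mathbb I^n)}}{\big\|f\big\|_{\ell^2(\mathbb I^n)}}<\infty,$$ where $n$ ranges over the positive integers.
   Context: For a positive integer $n$, $\mathbb I^n:=\{0,1\}^n$ is the hypercube with the Hamming metric $d(x,y):=|\{j:x(j)\neq y(j)\}|$. For $k\in\{0,1,\dots,n\}$ and $f:\mathbb I^n\to\mathbb C$, the spherical mean is $$S_kf(x):=\frac1{\binom nk}\sum_{y\in\mathbb I^n,\ d(x,y)=k}f(y),\qquad x\in\mathbb I^n.$$ The norm is $\|f\|_{\ell^2(\mathbb I^n)}:=\big(\sum_{x\in\mathbb I^n}|f(x)|^2\big)^{1/2}$. For $r\in[1,\infty)$, $Z\subseteq\{0,1,\dots,n\}$ and $x\in\mathbb I^n$, the $r$-variation seminorm is $$V_r(S_kf(x):k\in Z):=\max_{k_0<k_1<\dots<k_J,\ k_j\in Z}\Big(\sum_{j=1}^J|S_{k_{j-1}}f(x)-S_{k_j}f(x)|^r\Big)^{1/r},$$ the maximum being over all finite nonempty strictly increasing sequences in $Z$. $V_r(S_kf:k\in Z)$ denotes the function $\mathbb I^n\ni x\mapsto V_r(S_kf(x):k\in Z)$. $2\mathbb Z+q$ is the set of integers congruent to $q$ modulo $2$. *)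

theory Defs
  imports "HOL-Analysis.Analysis"
begin

text \<open>
  The dimension \<open>n\<close> varies inside the statement, so points of the hypercube are
  extensional functions on \<open>{1..n}\<close>; they are in bijection with \<open>{0,1}\<close>-valued \<open>n\<close>-tuples.
\<close>

definition cube :: "nat \<Rightarrow> (nat \<Rightarrow> nat) set" where
  "cube n = {1..n} \<rightarrow>\<^sub>E {0, 1}"

definition hamming_dist :: "nat \<Rightarrow> (nat \<Rightarrow> nat) \<Rightarrow> (nat \<Rightarrow> nat) \<Rightarrow> nat" where
  "hamming_dist n x y = card {j \<in> {1..n}. x j \<noteq> y j}"

definition spherical_mean ::
    "nat \<Rightarrow> nat \<Rightarrow> ((nat \<Rightarrow> nat) \<Rightarrow> complex) \<Rightarrow> (nat \<Rightarrow> nat) \<Rightarrow> complex" where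
  "spherical_mean n k f x =
     (1 / of_nat (n choose k)) * (\<Sum>y\<in>{y \<in> cube n. hamming_dist n x y = k}. f y)"

definition cube_norm :: "nat \<Rightarrow> ((nat \<Rightarrow> nat) \<Rightarrow> 'a::real_normed_vector) \<Rightarrow> real" where
  "cube_norm n f = L2_set (\<lambda>x. norm (f x)) (cube n)"

text \<open>
  A strictly increasing sequence \<open>k 0 < \<dots> < k J\<close> in \<open>Z\<close> is a function \<open>k\<close> of which only the
  values on \<open>{0..J}\<close> matter. The case \<open>J = 0\<close> is included and contributes the value \<open>0\<close>.
\<close>

definition variation_sums :: "real \<Rightarrow> (nat \<Rightarrow> complex) \<Rightarrow> nat set \<Rightarrow> real set" where
  "variation_sums r a Z =
     {(\<Sum>j=1..J. cmod (a (k (j - 1)) - a (k j)) powr r) powr (1 / r) | (J::nat) (k :: nat \<Rightarrow> nat).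
        strict_mono_on {0..J} k \<and> k ` {0..J} \<subseteq> Z}"

definition variation :: "real \<Rightarrow> (nat \<Rightarrow> complex) \<Rightarrow> nat set \<Rightarrow> real" where
  "variation r a Z = Max (variation_sums r a Z)"

text \<open>For finite nonempty \<open>Z\<close> the maximum is a genuine one.\<close>

lemma finite_variation_sums:
  assumes "finite Z"
  shows "finite (variation_sums r a Z)"
proof -
  let ?v = "\<lambda>(J::nat) (k :: nat \<Rightarrow> nat). (\<Sum>j=1..J. cmod (a (k (j - 1)) - a (k j)) powr r) powr (1 / r)"
  have "variation_sums r a Z \<subseteq> (\<Union>J\<in>{..card Z}. ?v J ` ({0..J} \<rightarrow>\<^sub>E Z))"
  proof
    fix v assume "v \<in> variation_sums r a Z"
    then obtain J k where v: "v = ?v J k" and mono: "strict_mono_on {0..J} k"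
      and sub: "k ` {0..J} \<subseteq> Z"
      unfolding variation_sums_def by blast
    have "card (k ` {0..J}) = Suc J"
      using strict_mono_on_imp_inj_on[OF mono] by (simp add: card_image)
    with card_mono[OF assms sub] have J: "J \<in> {..card Z}" by simp
    have "v = ?v J (restrict k {0..J})"
      unfolding v by (intro arg_cong2[where f = "(powr)"] sum.cong refl) auto
    moreover have "restrict k {0..J} \<in> {0..J} \<rightarrow>\<^sub>E Z" using sub by auto
    ultimately show "v \<in> (\<Union>J\<in>{..card Z}. ?v J ` ({0..J} \<rightarrow>\<^sub>E Z))" using J by blast
  qed
  moreover have "finite (\<Union>J\<in>{..card Z}. ?v J ` ({0..J} \<rightarrow>\<^sub>E Z))"
    using assms by (intro finite_UN_I finite_imageI finite_PiE) auto
  ultimately show ?thesis by (rule finite_subset)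
qed

lemma variation_sums_nonempty:
  assumes "Z \<noteq> {}"
  shows "variation_sums r a Z \<noteq> {}"
proof -
  obtain z where "z \<in> Z" using assms by blast
  then have "strict_mono_on {0..0::nat} (\<lambda>_. z) \<and> (\<lambda>_. z) ` {0..0::nat} \<subseteq> Z"
    by (auto simp: strict_mono_on_def)
  then show ?thesis unfolding variation_sums_def by blast
qed

text \<open>Functions on the cube are extensional too, so that the zero function is a single point.\<close>

definition cube_functions :: "nat \<Rightarrow> ((nat \<Rightarrow> nat) \<Rightarrow> complex) set" where
  "cube_functions n = cube n \<rightarrow>\<^sub>E UNIV"

definition cube_zero :: "nat \<Rightarrow> (nat \<Rightarrow> nat) \<Rightarrow> complex" where
  "cube_zero n = (\<lambda>x\<in>cube n. 0)"

end

theory Submission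
  imports Defs "HOL-Computational_Algebra.Polynomial"
begin

text \<open>
  On the Walsh basis \<open>S\<^sub>k\<close> is a multiplier with eigenvalues \<open>\<kappa>\<^sub>k(m)\<close>, normalised Krawtchouk polynomials
  evaluated at the frequency \<open>m\<close>. The antipodal map (\<open>k \<mapsto> n - k\<close>) and its dual (\<open>m \<mapsto> n - m\<close>, where the
  parity of \<open>k\<close> enters) reduce everything to \<open>k, m \<le> n / 2\<close>. There \<open>S\<^sub>k\<close> is compared with
  \<open>P\<^sup>2\<^sup>k\<close>, where \<open>P = S\<^sub>1\<close> is the simple random walk.

  The bound \<open>\<bar>\<kappa>\<^sub>k(m)\<bar> \<le> 2 exp (- k m / (16 n))\<close> comes from pairing coordinates inside and outside the
  frequency set, \<open>(1 - z)(1 + z) = 1 - z\<^sup>2\<close>; the difference in \<open>k\<close> is \<open>2 m / n\<close> times an eigenvalue in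
  dimension \<open>n - 1\<close>. Hence the error multipliers \<open>h\<^sub>k\<close> satisfy
  \<open>\<Sum>\<^sub>k (k + 1) \<bar>h\<^sub>k\<^sub>+\<^sub>1 - h\<^sub>k\<bar>\<^sup>2 + \<bar>h\<^sub>k\<bar>\<^sup>2 / (k + 1) = O(1)\<close>, which controls even the 2-variation of the error.

  For the powers of \<open>P\<^sup>2\<close>, Rota's dilation writes \<open>P\<^sup>2\<^sup>k f(x)\<close> as a conditional expectation of a martingale,
  and the variation of a martingale is controlled by its jumps exceeding \<open>2\<^sup>-\<^sup>p\<close> times its running maximum:
  for each \<open>p\<close> the sum of the squares of such jumps is integrable by orthogonality, and the weights
  \<open>2\<^sup>-\<^sup>p\<^sup>(\<^sup>r\<^sup>-\<^sup>2\<^sup>)\<close> are summable because \<open>r > 2\<close>.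
\<close>

section \<open>Krawtchouk polynomials\<close>

text \<open>The generating function form turns the pairing and difference identities below into
  identities between polynomials.\<close>

definition krawtchouk :: "nat \<Rightarrow> nat \<Rightarrow> nat \<Rightarrow> real" where
  "krawtchouk n k m = coeff ([:1, -1:] ^ m * [:1, 1:] ^ (n - m)) k"

lemma prod_linear_monom:
  fixes e :: "'a \<Rightarrow> real"
  assumes "finite A"
  shows "(\<Prod>j\<in>A. [:0, e j:]) = monom (\<Prod>j\<in>A. e j) (card A)"
  using assms by (induction A rule: finite_induct) (auto simp: monom_Suc mult_monom monom_0 smult_monom)

text \<open>Expanding the product of the factors \<open>1 + e j * z\<close> over subsets of
  \<open>S\<close>, the subsets of size \<open>k\<close> give exactly the terms of degree
  \<open>k\<close>. This identifies the coefficient with a character sum over a sphere.\<close>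

lemma sum_signs_eq_krawtchouk:
  assumes S: "finite S" "card S = n" and "M \<subseteq> S"
  shows "(\<Sum>A | A \<subseteq> S \<and> card A = k. (-1) ^ card (A \<inter> M)) = krawtchouk n k (card M)"
proof -
  let ?e = "\<lambda>j. if j \<in> M then -1 else (1::real)"
  have fM: "finite M" using assms finite_subset by blast
  have e: "(\<Prod>j\<in>A. ?e j) = (-1) ^ card (A \<inter> M)" if "A \<subseteq> S" for A
    using finite_subset[OF that S(1)] by (simp add: prod.If_cases)
  have "(\<Prod>j\<in>S. [:0, ?e j:] + 1) = (\<Prod>j\<in>S. if j \<in> M then [:1, -1:] else [:1, 1:])"
    by (intro prod.cong) (auto simp: one_pCons)
  also have "\<dots> = [:1, -1:] ^ card M * [:1, 1:] ^ (n - card M)"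
    using S assms(3) fM by (simp add: prod.If_cases Int_absorb1 card_Diff_subset flip: Diff_eq)
  finally have "krawtchouk n k (card M) = coeff (\<Prod>j\<in>S. [:0, ?e j:] + 1) k"
    by (simp add: krawtchouk_def)
  also have "\<dots> = (\<Sum>A\<in>Pow S. coeff (\<Prod>j\<in>A. [:0, ?e j:]) k)"
    by (subst prod_add[OF S(1)]) (simp add: coeff_sum)
  also have "\<dots> = (\<Sum>A\<in>Pow S. if card A = k then (-1) ^ card (A \<inter> M) else 0)"
  proof (intro sum.cong refl)
    fix A assume "A \<in> Pow S"
    then show "coeff (\<Prod>j\<in>A. [:0, ?e j:]) k = (if card A = k then (-1) ^ card (A \<inter> M) else 0)"
      using finite_subset[OF _ S(1), of A] by (simp add: prod_linear_monom e)
  qed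
  also have "\<dots> = (\<Sum>A | A \<subseteq> S \<and> card A = k. (-1) ^ card (A \<inter> M))"
    using S(1) by (subst sum.inter_filter[symmetric]) auto
  finally show ?thesis by simp
qed

lemma sum_signs_eq_krawtchouk_lessThan:
  assumes "m \<le> n"
  shows "(\<Sum>A | A \<subseteq> {..<n} \<and> card A = k. (-1) ^ card (A \<inter> {..<m})) = krawtchouk n k m"
  using sum_signs_eq_krawtchouk[of "{..<n}" n "{..<m}" k] assms by simp

lemma abs_krawtchouk_le:
  assumes "m \<le> n"
  shows "\<bar>krawtchouk n k m\<bar> \<le> real (n choose k)"
proof -
  have "\<bar>krawtchouk n k m\<bar> \<le> (\<Sum>A | A \<subseteq> {..<n} \<and> card A = k. \<bar>(-1) ^ card (A \<inter> {..<m})\<bar>)"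
    unfolding sum_signs_eq_krawtchouk_lessThan[OF assms, symmetric] by (rule sum_abs)
  then show ?thesis by (simp add: n_subsets)
qed

text \<open>Replacing the frequency set by its complement changes \<open>card (A \<inter> M)\<close>
  to \<open>k - card (A \<inter> M)\<close>, hence each sign by \<open>(-1) ^ k\<close>.\<close>

lemma krawtchouk_reflect:
  assumes "m \<le> n"
  shows "krawtchouk n k (n - m) = (-1) ^ k * krawtchouk n k m"
proof -
  have "{m..<n} \<subseteq> {..<n}" by auto
  then have "krawtchouk n k (n - m) = (\<Sum>A | A \<subseteq> {..<n} \<and> card A = k. (-1) ^ card (A \<inter> {m..<n}))"
    using sum_signs_eq_krawtchouk[of "{..<n}" n "{m..<n}" k] by simp
  also have "\<dots> = (\<Sum>A | A \<subseteq> {..<n} \<and> card A = k. (-1) ^ k * (-1) ^ card (A \<inter> {..<m}))"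
  proof (intro sum.cong refl)
    fix A assume A: "A \<in> {A. A \<subseteq> {..<n} \<and> card A = k}"
    then have fin: "finite A" using finite_subset by auto
    have "A = (A \<inter> {m..<n}) \<union> (A \<inter> {..<m})" using A by auto
    moreover have "(A \<inter> {m..<n}) \<inter> (A \<inter> {..<m}) = {}" by auto
    ultimately have "card A = card (A \<inter> {m..<n}) + card (A \<inter> {..<m})"
      using fin by (metis card_Un_disjoint finite_Int)
    then have k: "k = card (A \<inter> {m..<n}) + card (A \<inter> {..<m})" using A by simp
    have "(-1::real) ^ k * (-1) ^ card (A \<inter> {..<m})
        = (-1) ^ card (A \<inter> {m..<n}) * ((-1) ^ card (A \<inter> {..<m}) * (-1) ^ card (A \<inter> {..<m}))"
      by (subst k) (simp add: power_add)
    then show "(-1::real) ^ card (A \<inter> {m..<n}) = (-1) ^ k * (-1) ^ card (A \<inter> {..<m})"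
      by (simp flip: power_add)
  qed
  also have "\<dots> = (-1) ^ k * krawtchouk n k m"
    by (simp add: sum_distrib_left flip: sum_signs_eq_krawtchouk_lessThan[OF assms])
  finally show ?thesis .
qed

text \<open>Both sides sum the symmetric sign \<open>(-1) ^ card (A \<inter> B)\<close> over all
  pairs of a \<open>k\<close>-set \<open>A\<close> and an \<open>m\<close>-set
  \<open>B\<close>.\<close>

lemma krawtchouk_sym:
  assumes "m \<le> n" "k \<le> n"
  shows "real (n choose m) * krawtchouk n k m = real (n choose k) * krawtchouk n m k"
proof -
  let ?P = "\<lambda>k. {A. A \<subseteq> {..<n} \<and> card A = k}"
  have *: "real (n choose m) * krawtchouk n k m = (\<Sum>B\<in>?P m. \<Sum>A\<in>?P k. (-1) ^ card (A \<inter> B))" for k m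
  proof -
    have "(\<Sum>B\<in>?P m. \<Sum>A\<in>?P k. (-1) ^ card (A \<inter> B)) = (\<Sum>B\<in>?P m. krawtchouk n k m)"
      by (intro sum.cong refl) (use sum_signs_eq_krawtchouk[of "{..<n}" n _ k] in auto)
    then show ?thesis by (simp add: n_subsets)
  qed
  show ?thesis unfolding * by (subst sum.swap) (simp add: Int_commute)
qed

text \<open>One factor \<open>1 - z\<close> and one factor \<open>1 + z\<close> are merged into
  \<open>1 - z^2\<close>.\<close>

lemma krawtchouk_pair:
  assumes "1 \<le> m" "m < n"
  shows "krawtchouk n (Suc (Suc k)) m
    = krawtchouk (n - 2) (Suc (Suc k)) (m - 1) - krawtchouk (n - 2) k (m - 1)"
proof -
  obtain m' where m: "m = Suc m'" using assms by (cases m) auto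
  define d where "d = n - m - 1"
  have n: "n = m' + d + 2" using assms m by (simp add: d_def)
  define G :: "real poly" where "G = [:1, -1:] ^ m' * [:1, 1:] ^ d"
  have "[:1, -1:] ^ m * [:1, 1:] ^ (n - m) = ([:1, -1:] * [:1, 1:]) * G"
    using n by (simp only: G_def m power_Suc ac_simps) (simp add: algebra_simps)
  also have "[:1, -1:] * [:1, 1:] = [:1, 0, -1::real:]" by simp
  also have "\<dots> * G = G - pCons 0 (pCons 0 G)" by simp
  finally show ?thesis
    by (simp add: krawtchouk_def m n flip: G_def)
qed

text \<open>Used with \<open>a = 1 - z\<close> and \<open>b = 1 + z\<close>. The extra factor
  \<open>b\<close> restores the power lost in differentiating \<open>b ^ d\<close>, so that
  \<open>d = 0\<close> fits the same formula.\<close>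

lemma mult_pderiv_powers:
  fixes a b :: "real poly"
  assumes a: "pderiv a = -1" and b: "pderiv b = 1"
  shows "b * pderiv (a ^ Suc m * b ^ d)
    = - smult (real (Suc m)) (a ^ m * b ^ Suc d) + smult (real d) (a ^ Suc m * b ^ d)"
proof -
  have sm: "smult (real i) p = of_nat i * p" for i and p :: "real poly"
    by (simp add: of_nat_poly)
  have A: "pderiv (a ^ Suc m) = - (of_nat (Suc m) * a ^ m)"
    by (simp add: pderiv_power_Suc a sm del: power_Suc of_nat_Suc)
  have B: "b * pderiv (b ^ d) = of_nat d * b ^ d"
  proof (cases d)
    case (Suc i)
    have "pderiv (b ^ Suc i) = of_nat (Suc i) * b ^ i"
      by (simp add: pderiv_power_Suc b sm del: power_Suc of_nat_Suc)
    then show ?thesis unfolding Suc by (simp only: power_Suc ac_simps)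
  qed simp
  have "b * pderiv (a ^ Suc m * b ^ d) = a ^ Suc m * (b * pderiv (b ^ d)) + b * b ^ d * pderiv (a ^ Suc m)"
    by (simp only: pderiv_mult algebra_simps)
  then show ?thesis unfolding A B sm by (simp only: power_Suc) (simp add: algebra_simps del: of_nat_Suc)
qed

text \<open>With \<open>F = (1 - z)^m (1 + z)^(n - m)\<close> one has
  \<open>n F - (1 + z) F' = 2 m (1 - z)^(m - 1) (1 + z)^(n - m)\<close>, because
  \<open>(1 - z) + (1 + z) = 2\<close>. The claim compares coefficients of
  \<open>z^k\<close>.\<close>

lemma krawtchouk_diff:
  assumes "1 \<le> m" "m \<le> n" "k \<le> n"
  shows "real (n - k) * krawtchouk n k m - real (Suc k) * krawtchouk n (Suc k) m
    = 2 * real m * krawtchouk (n - 1) k (m - 1)"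
proof -
  obtain m' where m: "m = Suc m'" using assms by (cases m) auto
  obtain d where n: "n = Suc (m' + d)" using assms m by (metis add_Suc le_Suc_ex)
  let ?a = "[:1, -1:] :: real poly" and ?b = "[:1, 1:] :: real poly"
  define F where "F = ?a ^ m * ?b ^ d"
  have K: "krawtchouk n i m = coeff F i" for i by (simp add: krawtchouk_def F_def n m)
  have D: "?b * pderiv F = - smult (real m) (?a ^ m' * ?b ^ Suc d) + smult (real d) F"
    unfolding F_def m by (rule mult_pderiv_powers) (simp_all add: pderiv_pCons one_pCons)
  have "smult (real n) F - ?b * pderiv F = smult (2 * real m) (?a ^ m' * ?b ^ d)"
  proof -
    have "smult (real n) F - ?b * pderiv F = smult (real m) (F + ?a ^ m' * ?b ^ Suc d)"
      unfolding D using n m by (simp add: smult_add_left smult_add_right algebra_simps flip: smult_add_left)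
    also have "F + ?a ^ m' * ?b ^ Suc d = (?a + ?b) * (?a ^ m' * ?b ^ d)"
      unfolding F_def m power_Suc by (simp only: algebra_simps)
    also have "?a + ?b = [:2:]" by simp
    finally show ?thesis by (simp add: mult.commute)
  qed
  then have "coeff (smult (real n) F - ?b * pderiv F) k = 2 * real m * krawtchouk (n - 1) k (m - 1)"
    by (simp add: krawtchouk_def n m)
  moreover have "coeff (?b * pderiv F) k = real (Suc k) * coeff F (Suc k) + real k * coeff F k"
    by (cases k) (auto simp: coeff_pderiv coeff_pCons)
  ultimately show ?thesis
    using assms by (simp add: K of_nat_diff algebra_simps)
qed

section \<open>Decay and differences of the normalised eigenvalues\<close>

text \<open>The proportion of \<open>k\<close>-sets that contain the first but not the second of two
  given points is \<open>k (n - k) / (n (n - 1))\<close>.\<close>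

lemma choose_mult_mult:
  assumes "1 \<le> k" "k < n"
  shows "real (n choose k) * (real (n - k) * real k) = real n * real (n - 1) * real ((n - 2) choose (k - 1))"
proof -
  obtain i where k: "k = Suc i" using assms by (cases k) auto
  define d where "d = n - k - 1"
  have n: "n = Suc (Suc (i + d))" using assms k by (simp add: d_def)
  have "Suc i * (n choose Suc i) = n * ((n - 1) choose i)"
    using Suc_times_binomial_eq[of "n - 1" i] n by (simp add: mult.commute)
  moreover have "(n - 1 - i) * ((n - 1) choose i) = (n - 1) * ((n - 2) choose i)"
    using binomial_absorb_comp[of "n - 1" i] n by (simp add: numeral_2_eq_2)
  ultimately have "(n - k) * (Suc i * (n choose Suc i)) = n * ((n - 1) * ((n - 2) choose i))"
    using k by simp
  then show ?thesis by (simp add: k n algebra_simps flip: of_nat_mult of_nat_add of_nat_Suc)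
qed

text \<open>Each of \<open>j\<close> pairings replaces \<open>n choose k\<close> by
  \<open>(n - 2 choose k) + (n - 2 choose k - 2)\<close>, which loses twice the middle binomial
  \<open>n - 2 choose k - 1\<close>, a share of at least \<open>2 L U / R^2\<close>. The margins
  \<open>2 * real j\<close> keep \<open>L\<close> and \<open>U\<close> valid lower bounds for
  \<open>k\<close> and \<open>n - k\<close> through all steps, since a pairing lowers either by at
  most 2.\<close>

lemma krawtchouk_decay_step:
  fixes L U R :: real
  assumes L: "0 \<le> L" and U: "0 \<le> U" and R: "2 * L * U \<le> R^2" "0 < R"
    and nR: "real n \<le> R"
    and k: "L + 2 * real j \<le> real k" "U + 2 * real j + real k \<le> real n"
    and m: "j \<le> m" "m + j \<le> n"
  shows "\<bar>krawtchouk n k m\<bar> \<le> (1 - 2 * L * U / R^2) ^ j * real (n choose k)"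
  using nR k m
proof (induction j arbitrary: n k m)
  case 0
  then show ?case using abs_krawtchouk_le[of m n k] by simp
next
  case (Suc j)
  define \<rho> where "\<rho> = 1 - 2 * L * U / R^2"
  have \<rho>: "0 \<le> \<rho>" using R by (simp add: \<rho>_def)
  have "2 \<le> real k" "real k + 2 \<le> real n" using Suc.prems L U by auto
  then have "2 \<le> k" "k + 2 \<le> n" by linarith+
  then obtain i where k: "k = Suc (Suc i)" by (metis add_2_eq_Suc le_Suc_ex)
  have pair: "krawtchouk n k m = krawtchouk (n - 2) k (m - 1) - krawtchouk (n - 2) i (m - 1)"
    unfolding k by (rule krawtchouk_pair) (use Suc.prems in auto)
  have "\<bar>krawtchouk (n - 2) k (m - 1)\<bar> \<le> \<rho> ^ j * real ((n - 2) choose k)"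
    unfolding \<rho>_def by (rule Suc.IH) (use Suc.prems \<open>k + 2 \<le> n\<close> in \<open>auto simp: of_nat_diff\<close>)
  moreover have "\<bar>krawtchouk (n - 2) i (m - 1)\<bar> \<le> \<rho> ^ j * real ((n - 2) choose i)"
    unfolding \<rho>_def by (rule Suc.IH) (use Suc.prems k \<open>k + 2 \<le> n\<close> in \<open>auto simp: of_nat_diff\<close>)
  ultimately have "\<bar>krawtchouk n k m\<bar> \<le> \<rho> ^ j * (real ((n - 2) choose k) + real ((n - 2) choose i))"
    unfolding pair distrib_left by linarith
  also have "\<dots> \<le> \<rho> ^ j * (\<rho> * real (n choose k))"
  proof -
    obtain d where n: "n = Suc (Suc d)" using \<open>k + 2 \<le> n\<close> by (metis add_2_eq_Suc' le_Suc_ex add.commute add_Suc_right add.assoc)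
    have split: "n choose k = (d choose k) + 2 * (d choose Suc i) + (d choose i)"
      by (simp add: n k)
    have "real (n choose k) * (L * U) \<le> real (n choose k) * (real k * real (n - k))"
      using Suc.prems L U \<open>k + 2 \<le> n\<close> by (intro mult_left_mono mult_mono) (auto simp: of_nat_diff)
    also have "\<dots> = real n * real (n - 1) * real (d choose Suc i)"
      using choose_mult_mult[of k n] \<open>k + 2 \<le> n\<close> k n by (simp add: mult_ac)
    also have "\<dots> \<le> R^2 * real (d choose Suc i)"
      unfolding power2_eq_square using Suc.prems by (intro mult_right_mono mult_mono) auto
    finally have "real (n choose k) * (L * U) / R^2 \<le> real (d choose Suc i)"
      using R by (simp add: field_simps)
    moreover have "\<rho> * real (n choose k) = real (n choose k) - 2 * (real (n choose k) * (L * U) / R^2)"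
      by (simp add: \<rho>_def left_diff_distrib)
    ultimately show ?thesis using split n \<rho> by (intro mult_left_mono) auto
  qed
  finally show ?case by (simp add: \<rho>_def mult_ac)
qed

definition kraw_eig :: "nat \<Rightarrow> nat \<Rightarrow> nat \<Rightarrow> real" where
  "kraw_eig n k m = krawtchouk n k m / real (n choose k)"

lemma kraw_eig_sym: "m \<le> n \<Longrightarrow> k \<le> n \<Longrightarrow> kraw_eig n k m = kraw_eig n m k"
  using krawtchouk_sym[of m n k] by (simp add: kraw_eig_def field_simps)

lemma abs_kraw_eig_le_1: "m \<le> n \<Longrightarrow> \<bar>kraw_eig n k m\<bar> \<le> 1"
  using abs_krawtchouk_le[of m n k] by (auto simp: kraw_eig_def abs_div intro!: divide_le_eq_1[THEN iffD2])

lemma kraw_eig_reflect: "m \<le> n \<Longrightarrow> kraw_eig n k (n - m) = (-1) ^ k * kraw_eig n k m"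
  by (simp add: kraw_eig_def krawtchouk_reflect)

lemma kraw_eig_0 [simp]: "kraw_eig n 0 m = 1"
  by (simp add: kraw_eig_def krawtchouk_def coeff_mult_0 coeff_0_power)

text \<open>This is \<open>krawtchouk_diff\<close> after normalisation:
  \<open>n (n - 1 choose k)\<close>, \<open>(n - k) (n choose k)\<close> and
  \<open>(k + 1) (n choose k + 1)\<close> coincide.\<close>

lemma kraw_eig_diff:
  assumes "1 \<le> m" "m \<le> n" "k < n"
  shows "kraw_eig n k m - kraw_eig n (Suc k) m = 2 * real m / real n * kraw_eig (n - 1) k (m - 1)"
proof -
  have "n * ((n - 1) choose k) = (n - k) * (n choose k)"
    using binomial_absorb_comp[of n k] by simp
  then have 1: "real n * real ((n - 1) choose k) = real (n - k) * real (n choose k)"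
    by (metis of_nat_mult)
  have "Suc k * (n choose Suc k) = (n - k) * (n choose k)"
    using Suc_times_binomial_add[of k "n - k - 1"] binomial_absorb_comp[of n k] binomial_absorption[of k n] assms by simp
  then have 2: "real (Suc k) * real (n choose Suc k) = real (n - k) * real (n choose k)"
    by (metis of_nat_mult)
  have pos: "0 < real (n choose k)" "0 < real (n choose Suc k)" "0 < real ((n - 1) choose k)"
    "0 < real (n - k)" "0 < real n" "0 < real (Suc k)"
    using assms by (auto simp: zero_less_binomial_iff)
  have "kraw_eig n (Suc k) m = real (Suc k) * krawtchouk n (Suc k) m / (real (n - k) * real (n choose k))"
    using pos unfolding 2[symmetric] kraw_eig_def by simp
  moreover have "kraw_eig n k m = real (n - k) * krawtchouk n k m / (real (n - k) * real (n choose k))"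
    using pos unfolding kraw_eig_def by simp
  ultimately have "kraw_eig n k m - kraw_eig n (Suc k) m
      = (2 * real m * krawtchouk (n - 1) k (m - 1)) / (real (n - k) * real (n choose k))"
    using krawtchouk_diff[of m n k] assms by (simp only: diff_divide_distrib[symmetric] less_imp_le)
  also have "\<dots> = 2 * real m / real n * kraw_eig (n - 1) k (m - 1)"
    unfolding 1[symmetric] kraw_eig_def by simp
  finally show ?thesis .
qed

text \<open>By \<open>kraw_eig_sym\<close> only \<open>m \<le> k\<close> needs an argument. Then
  about \<open>m / 4\<close> pairings are available, each gaining a factor
  \<open>1 - k / (4 n)\<close>.\<close>

lemma kraw_eig_decay:
  assumes "2 * k \<le> n" "2 * m \<le> n" "1 \<le> n"
  shows "\<bar>kraw_eig n k m\<bar> \<le> 2 * exp (- (real k * real m / (16 * real n)))"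
proof -
  have *: "\<bar>kraw_eig n k m\<bar> \<le> 2 * exp (- (real k * real m / (16 * real n)))"
    if k: "2 * k \<le> n" and mk: "m \<le> k" for k m
  proof -
    \<comment> \<open>With \<open>j\<close> pairings,
      \<open>4 * j \<le> m \<le> k \<le> n / 2\<close> leaves room for the lower bounds
      \<open>L = k / 2\<close> and \<open>U = n / 4\<close>.\<close>
    define j where "j = m div 4"
    have j: "4 * j \<le> m" "m \<le> 4 * j + 3" by (auto simp: j_def)
    have n: "0 < real n" using assms by simp
    have "\<bar>krawtchouk n k m\<bar> \<le> (1 - 2 * (real k / 2) * (real n / 4) / (real n)^2) ^ j * real (n choose k)"
    proof (rule krawtchouk_decay_step)
      have "real k \<le> real n" using k by simp
      then show "2 * (real k / 2) * (real n / 4) \<le> (real n)\<^sup>2"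
        using mult_mono[of "real k" "real n" "real n / 4" "real n"] by (simp add: power2_eq_square)
    qed (use j k mk n in \<open>auto simp: field_simps\<close>)
    also have "1 - 2 * (real k / 2) * (real n / 4) / (real n)^2 = 1 - real k / (4 * real n)"
      using n by (simp add: power2_eq_square)
    finally have "\<bar>kraw_eig n k m\<bar> \<le> (1 - real k / (4 * real n)) ^ j"
      using k by (simp add: kraw_eig_def abs_div divide_le_eq)
    also have "\<dots> \<le> exp (- (real k / (4 * real n))) ^ j"
      using exp_ge_add_one_self[of "- (real k / (4 * real n))"] k n
      by (intro power_mono) (auto simp: field_simps)
    also have "\<dots> = exp (- (real j * real k / (4 * real n)))"
      by (simp flip: exp_of_nat_mult)
    \<comment> \<open>Rounding in \<open>m div 4\<close> loses at most 3 in \<open>m\<close>, hence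
      at most \<open>3 k / (16 n) \<le> 3 / 32\<close> in the exponent; the factor 2 absorbs
      it.\<close>
    also have "\<dots> \<le> exp (3 / 32 + - (real k * real m / (16 * real n)))"
    proof -
      have "real k * real m \<le> real k * (4 * real j + 3)" using j by (intro mult_left_mono) auto
      then have "real k * real m / (16 * real n) \<le> real k * (4 * real j + 3) / (16 * real n)"
        using n by (intro divide_right_mono) auto
      also have "\<dots> = real j * real k / (4 * real n) + 3 * real k / (16 * real n)"
        using n by (simp add: field_simps)
      also have "3 * real k / (16 * real n) \<le> 3 / 32"
        using n k by (simp add: field_simps)
      finally show ?thesis by simp
    qed
    also have "\<dots> \<le> 2 * exp (- (real k * real m / (16 * real n)))"
    proof -
      have "exp (3 / 32 :: real) \<le> 2"
        using exp_bound[of "3 / 32 :: real"] by (simp add: power2_eq_square)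
      then show ?thesis by (simp only: exp_add) simp
    qed
    finally show ?thesis .
  qed
  show ?thesis
  proof (cases "m \<le> k")
    case True
    then show ?thesis using *[of k m] assms by simp
  next
    case False
    then show ?thesis using *[of m k] assms kraw_eig_sym[of m n k] by (simp add: mult.commute)
  qed
qed

section \<open>Comparison with even powers of the simple random walk\<close>

text \<open>The symbol of \<open>S_k - P^(2 k)\<close>. The power \<open>2 k\<close> is dictated by
  the dilation argument. First order agreement is not sought: the error vanishes when
  \<open>k\<close> or \<open>m\<close> is 0 and decays in \<open>k m / n\<close>.\<close>

definition eig_err :: "nat \<Rightarrow> nat \<Rightarrow> nat \<Rightarrow> real" where
  "eig_err n k m = kraw_eig n k m - (1 - 2 * real m / real n) ^ (2 * k)"

lemma eig_err_0 [simp]: "eig_err n 0 m = 0"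
  by (simp add: eig_err_def)

lemma kraw_eig_zero_freq: "k \<le> n \<Longrightarrow> kraw_eig n k 0 = 1"
  using kraw_eig_sym[of 0 n k] by simp

text \<open>With \<open>s = m / n\<close> and \<open>e = exp (- k s / 16)\<close>, increments of the
  error are at most \<open>12 s e\<close> and the error itself is at most both \<open>12 s k\<close>
  and \<open>3 e\<close>. So each summand is \<open>O(s)\<close> times
  \<open>exp (- s / 16) ^ k\<close>, and the geometric series contributes
  \<open>O(1 / s)\<close>.\<close>

lemma eig_err_square_function:
  assumes n: "1 \<le> n" and m: "2 * m \<le> n"
  shows "(\<Sum>k<n div 2. real (Suc k) * (eig_err n (Suc k) m - eig_err n k m)\<^sup>2
            + (eig_err n k m)\<^sup>2 / real (Suc k)) \<le> 79488"
proof (cases "m = 0")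
  case True
  have "eig_err n k m = 0" if "k \<le> n" for k
    using that by (simp add: eig_err_def True kraw_eig_zero_freq)
  then have "(\<Sum>k<n div 2. real (Suc k) * (eig_err n (Suc k) m - eig_err n k m)\<^sup>2
            + (eig_err n k m)\<^sup>2 / real (Suc k)) = 0"
    by (intro sum.neutral) auto
  then show ?thesis by simp
next
  case False
  define s where "s = real m / real n"
  define lam where "lam = 1 - 2 * s"
  have s: "0 < s" "s \<le> 1 / 2" using n m False by (auto simp: s_def field_simps)
  have lam: "0 \<le> lam" "lam \<le> exp (- (2 * s))" "lam \<le> 1"
    using s exp_ge_add_one_self[of "- (2 * s)"] by (auto simp: lam_def)
  have err: "eig_err n k m = kraw_eig n k m - lam ^ (2 * k)" for k
    by (simp add: eig_err_def lam_def s_def)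
  have pow: "lam ^ (2 * k) \<le> exp (- (real k * s / 16))" for k
  proof -
    have "lam ^ (2 * k) \<le> exp (- (2 * s)) ^ (2 * k)" using lam by (intro power_mono)
    also have "\<dots> = exp (- (4 * real k * s))" by (simp add: mult_ac flip: exp_of_nat_mult)
    also have "\<dots> \<le> exp (- (real k * s / 16))" using s by simp
    finally show ?thesis .
  qed
  have diff: "\<bar>eig_err n (Suc k) m - eig_err n k m\<bar> \<le> 12 * s * exp (- (real k * s / 16))"
    if k: "k < n div 2" for k
  proof -
    have n2: "2 \<le> n" "2 * Suc k \<le> n" using k by auto
    have "\<bar>kraw_eig (n - 1) k (m - 1)\<bar> \<le> 2 * exp (- (real k * real (m - 1) / (16 * real (n - 1))))"
      by (rule kraw_eig_decay) (use n2 m in auto)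
    \<comment> \<open>Passing from dimension \<open>n - 1\<close> and frequency \<open>m - 1\<close>
      back to \<open>n\<close> and \<open>m\<close> costs at most
      \<open>k / (16 n) \<le> 1 / 32\<close> in the exponent.\<close>
    also have "\<dots> \<le> 2 * exp (1 / 32 - real k * s / 16)"
    proof -
      have "real k * s = real k * real (m - 1) / real n + real k / real n"
        using False n by (simp add: s_def field_simps of_nat_diff)
      also have "\<dots> \<le> real k * real (m - 1) / real (n - 1) + 1 / 2"
        using n2 by (intro add_mono divide_left_mono) (auto simp: field_simps)
      finally show ?thesis by (simp add: mult.commute)
    qed
    also have "\<dots> = 2 * exp (1 / 32) * exp (- (real k * s / 16))"
      by (simp only: diff_conv_add_uminus exp_add mult.assoc)
    also have "\<dots> \<le> 4 * exp (- (real k * s / 16))"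
    proof -
      have "exp (1 / 32 :: real) \<le> 2"
        using exp_bound[of "1 / 32 :: real"] by (simp add: power2_eq_square)
      then show ?thesis by (intro mult_right_mono) auto
    qed
    finally have "2 * s * \<bar>kraw_eig (n - 1) k (m - 1)\<bar> \<le> 2 * s * (4 * exp (- (real k * s / 16)))"
      using s by (intro mult_left_mono) auto
    moreover have "\<bar>kraw_eig n k m - kraw_eig n (Suc k) m\<bar> = 2 * s * \<bar>kraw_eig (n - 1) k (m - 1)\<bar>"
      using kraw_eig_diff[of m n k] False m k by (simp add: s_def abs_mult)
    ultimately have 1: "\<bar>kraw_eig n k m - kraw_eig n (Suc k) m\<bar> \<le> 8 * s * exp (- (real k * s / 16))"
      by simp
    have "lam ^ (2 * k) - lam ^ (2 * Suc k) = lam ^ (2 * k) * (4 * s * (1 - s))"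
      by (simp add: lam_def algebra_simps power2_eq_square)
    also have "\<dots> \<le> exp (- (real k * s / 16)) * (4 * s)"
    proof (rule mult_mono[OF pow])
      show "4 * s * (1 - s) \<le> 4 * s" "0 \<le> 4 * s * (1 - s)" using s by auto
    qed (use s in auto)
    finally have "lam ^ (2 * k) - lam ^ (2 * Suc k) \<le> 4 * s * exp (- (real k * s / 16))"
      by (simp add: mult_ac)
    moreover have "lam ^ (2 * Suc k) \<le> lam ^ (2 * k)"
      using lam by (intro power_decreasing) auto
    ultimately show ?thesis using 1 unfolding err by linarith
  qed
  \<comment> \<open>Telescoping from \<open>eig_err n 0 m = 0\<close>. This handles small
    \<open>k\<close>, where exponential decay alone would leave a divergent sum of
    \<open>1 / (k + 1)\<close>.\<close>
  have lin: "\<bar>eig_err n k m\<bar> \<le> 12 * s * real k" if "k \<le> n div 2" for k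
    using that
  proof (induction k)
    case (Suc k)
    have "\<bar>eig_err n (Suc k) m - eig_err n k m\<bar> \<le> 12 * s * 1"
      by (rule order.trans[OF diff]) (use Suc.prems s in \<open>auto intro!: mult_left_mono\<close>)
    then show ?case using Suc by (simp add: algebra_simps)
  qed simp
  have dec: "\<bar>eig_err n k m\<bar> \<le> 3 * exp (- (real k * s / 16))" if "k < n div 2" for k
  proof -
    have "\<bar>kraw_eig n k m\<bar> \<le> 2 * exp (- (real k * s / 16))"
      using kraw_eig_decay[of k n m] that n m by (simp add: s_def mult.commute)
    then show ?thesis using pow[of k] lam unfolding err by (smt (verit) zero_le_power)
  qed
  have main: "real (Suc k) * (eig_err n (Suc k) m - eig_err n k m)\<^sup>2 + (eig_err n k m)\<^sup>2 / real (Suc k)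
      \<le> 2484 * s * exp (- (s / 16)) ^ k" (is "?A + ?B \<le> _") if k: "k < n div 2" for k
  proof -
    define e where "e = exp (- (real k * s / 16))"
    have e: "0 < e" "e \<le> 1" using s by (auto simp: e_def)
    \<comment> \<open>This is \<open>t * exp (- t) \<le> 1\<close> with \<open>t = k s / 16\<close>.
      It absorbs the weight \<open>Suc k\<close> at the price of one of the two factors
      \<open>s e\<close>.\<close>
    have tx: "real k * s * e \<le> 16"
    proof -
      have "real k * s / 16 \<le> exp (real k * s / 16)"
        using exp_ge_add_one_self[of "real k * s / 16"] by linarith
      then have "real k * s / 16 * e \<le> exp (real k * s / 16) * e"
        using e by (intro mult_right_mono) auto
      also have "\<dots> = 1" by (simp add: e_def flip: exp_add)
      finally show ?thesis by simp
    qed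
    have "?A \<le> real (Suc k) * (12 * s * e)\<^sup>2"
      using diff[OF k] s e by (intro mult_left_mono) (auto simp: e_def abs_le_square_iff[symmetric])
    also have "\<dots> = 144 * (s * e + real k * s * e) * (s * e)"
      by (simp add: power2_eq_square algebra_simps)
    also have "\<dots> \<le> 144 * 17 * (s * e)"
      using tx s e mult_mono[of s 1 e 1] by (intro mult_right_mono mult_left_mono) auto
    finally have A: "?A \<le> 2448 * (s * e)" by simp
    have "(eig_err n k m)\<^sup>2 = \<bar>eig_err n k m\<bar> * \<bar>eig_err n k m\<bar>" by (simp add: power2_eq_square)
    \<comment> \<open>One factor is bounded linearly, to cancel the denominator
      \<open>Suc k\<close>, the other exponentially, to keep summability.\<close>
    also have "\<dots> \<le> (12 * s * real k) * (3 * e)"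
      using lin[of k] dec[OF k] k s e by (intro mult_mono) (auto simp: e_def)
    also have "\<dots> \<le> 36 * (s * e) * real (Suc k)" using s e by (simp add: algebra_simps)
    finally have B: "?B \<le> 36 * (s * e)" by (simp add: divide_le_eq)
    have "exp (- (s / 16)) ^ k = e" by (simp add: e_def flip: exp_of_nat_mult)
    then show ?thesis using A B by simp
  qed
  define x where "x = exp (- (s / 16))"
  have x: "0 \<le> x" "x < 1" using s by (auto simp: x_def)
  \<comment> \<open>A lower bound for \<open>1 - x\<close> proportional to \<open>s\<close>, so that
    the prefactor \<open>s\<close> cancels the sum of the geometric series.\<close>
  have "x \<le> 1 / (1 + s / 16)"
    using exp_ge_add_one_self[of "s / 16"] s by (simp add: x_def exp_minus field_simps)
  also have "\<dots> \<le> 1 - s / 32" using s by (simp add: field_simps power2_eq_square)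
  finally have sx: "s \<le> 32 * (1 - x)" by simp
  have "(\<Sum>k<n div 2. real (Suc k) * (eig_err n (Suc k) m - eig_err n k m)\<^sup>2
            + (eig_err n k m)\<^sup>2 / real (Suc k)) \<le> (\<Sum>k<n div 2. 2484 * s * x ^ k)"
    unfolding x_def by (intro sum_mono main) auto
  also have "\<dots> = 2484 * s * ((1 - x ^ (n div 2)) / (1 - x))"
    using x by (simp add: sum_gp_strict flip: sum_distrib_left)
  also have "\<dots> \<le> 2484 * s * (1 / (1 - x))"
    using s x by (intro mult_left_mono divide_right_mono) auto
  also have "\<dots> \<le> 79488" using sx x by (simp add: field_simps)
  finally show ?thesis .
qed

section \<open>Variation bounds\<close>

text \<open>Monotone rather than strictly monotone sequences make this notion stable under reparametrisation.\<close>

definition variation_le :: "real \<Rightarrow> (nat \<Rightarrow> complex) \<Rightarrow> nat set \<Rightarrow> real \<Rightarrow> bool" where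
  "variation_le r a Z W \<longleftrightarrow> 0 \<le> W \<and> (\<forall>(J::nat) k. mono_on {0..J} k \<longrightarrow> k ` {0..J} \<subseteq> Z \<longrightarrow>
     (\<Sum>j=1..J. cmod (a (k (j - 1)) - a (k j)) powr r) \<le> W powr (r / 2))"

lemma sum_increments:
  fixes w :: "nat \<Rightarrow> real" and J :: nat
  shows "(\<Sum>j=1..J. w (k j) - w (k (j - 1))) = w (k J) - w (k 0)"
  by (induction J) auto

text \<open>The control function method: increments dominated by those of a single function
  \<open>w\<close> telescope along every monotone sequence.\<close>

lemma sum_le_control:
  fixes w :: "nat \<Rightarrow> real" and k :: "nat \<Rightarrow> nat" and J :: nat
  assumes mono: "mono_on {0..J} k" and sub: "k ` {0..J} \<subseteq> Z"
    and le: "\<And>a b. a \<in> Z \<Longrightarrow> b \<in> Z \<Longrightarrow> a \<le> b \<Longrightarrow> d a b \<le> w b - w a"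
  shows "(\<Sum>j=1..J. d (k (j - 1)) (k j)) \<le> w (k J) - w (k 0)"
proof -
  have "(\<Sum>j=1..J. d (k (j - 1)) (k j)) \<le> (\<Sum>j=1..J. w (k j) - w (k (j - 1)))"
  proof (intro sum_mono le)
    fix j assume j: "j \<in> {1..J}"
    show "k (j - 1) \<in> Z" "k j \<in> Z" using sub j by auto
    show "k (j - 1) \<le> k j" using j by (intro mono_onD[OF mono]) auto
  qed
  then show ?thesis by (simp only: sum_increments)
qed

section \<open>Convexity inequalities for real powers\<close>

lemma power2_powr_half: "0 \<le> x \<Longrightarrow> (x\<^sup>2) powr (p / 2) = x powr p" for x p :: real
  using powr_powr[of x 2 "p / 2"] by (cases "x = 0") (auto simp: powr_numeral)

lemma powr_ge_tangent:
  fixes x m p :: real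
  assumes "1 \<le> p" "0 \<le> x" "0 < m"
  shows "m powr p + p * m powr (p - 1) * (x - m) \<le> x powr p"
proof (cases "x = 0")
  case True
  have "m powr p = m powr (p - 1) * m"
    using assms by (simp add: powr_diff)
  moreover have "1 * (m powr (p - 1) * m) \<le> p * (m powr (p - 1) * m)"
    using assms by (intro mult_right_mono) auto
  ultimately show ?thesis using True by (simp add: algebra_simps)
next
  case False
  have "((\<lambda>x. x powr p) has_real_derivative p * m powr (p - 1)) (at m within {0<..})"
    using assms by (auto intro!: derivative_eq_intros)
  then have "p * m powr (p - 1) * (x - m) \<le> x powr p - m powr p"
    using assms False by (intro convex_on_imp_above_tangent[OF powr_convex[of p]]) (auto simp: connected_Ioi interior_open convex_on_def)
  then show ?thesis by simp
qed

text \<open>Jensen's inequality, by averaging the tangent line at the mean \<open>m\<close>: the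
  linear terms cancel.\<close>

lemma powr_sum_le:
  fixes W t :: "'a \<Rightarrow> real"
  assumes "finite H" and W: "\<And>h. h \<in> H \<Longrightarrow> 0 \<le> W h" "(\<Sum>h\<in>H. W h) = 1"
    and t: "\<And>h. h \<in> H \<Longrightarrow> 0 \<le> t h" and p: "1 \<le> p"
  shows "(\<Sum>h\<in>H. W h * t h) powr p \<le> (\<Sum>h\<in>H. W h * t h powr p)"
proof (cases "(\<Sum>h\<in>H. W h * t h) = 0")
  case True
  then show ?thesis using W t by (auto intro!: sum_nonneg)
next
  case False
  define m where "m = (\<Sum>h\<in>H. W h * t h)"
  have m: "0 < m" using False W t by (simp add: m_def less_le sum_nonneg)
  have "m powr p = (\<Sum>h\<in>H. W h * (m powr p + p * m powr (p - 1) * (t h - m)))"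
  proof -
    define B where "B = p * m powr (p - 1)"
    have "(\<Sum>h\<in>H. W h * (m powr p + B * (t h - m)))
        = (\<Sum>h\<in>H. (m powr p - B * m) * W h + B * (W h * t h))"
      by (intro sum.cong) (auto simp: algebra_simps)
    also have "\<dots> = (m powr p - B * m) * (\<Sum>h\<in>H. W h) + B * (\<Sum>h\<in>H. W h * t h)"
      by (simp only: sum.distrib sum_distrib_left)
    finally show ?thesis using W by (simp flip: m_def B_def)
  qed
  also have "\<dots> \<le> (\<Sum>h\<in>H. W h * t h powr p)"
    using W t p m by (intro sum_mono mult_left_mono powr_ge_tangent) auto
  finally show ?thesis by (simp add: m_def)
qed

text \<open>A form of Minkowski's inequality for the average of \<open>\<ell>\<^sup>r\<close>-valued functions: write
  \<open>\<bar>d\<bar> = sqrt Y * t\<close>, apply Cauchy--Schwarz, and then Jensen's inequality with exponent \<open>r / 2\<close>.\<close>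

lemma sum_average_powr_le:
  fixes W Y :: "'a \<Rightarrow> real" and d :: "'a \<Rightarrow> 'b \<Rightarrow> complex"
  assumes H: "finite H" and W: "\<And>h. h \<in> H \<Longrightarrow> 0 \<le> W h" "(\<Sum>h\<in>H. W h) = 1"
    and Y: "\<And>h. h \<in> H \<Longrightarrow> 0 \<le> Y h" and I: "finite I"
    and d: "\<And>h. h \<in> H \<Longrightarrow> (\<Sum>j\<in>I. cmod (d h j) powr r) \<le> Y h powr (r / 2)"
    and r: "2 \<le> r"
  shows "(\<Sum>j\<in>I. cmod (\<Sum>h\<in>H. W h *\<^sub>R d h j) powr r) \<le> (\<Sum>h\<in>H. W h * Y h) powr (r / 2)"
proof -
  define S where "S = (\<Sum>h\<in>H. W h * Y h)"
  define t where "t h j = cmod (d h j) / sqrt (Y h)" for h j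
  have S: "0 \<le> S" using W Y by (simp add: S_def sum_nonneg)
  have t0: "0 \<le> t h j" if "h \<in> H" for h j using that Y by (simp add: t_def)
  have dt: "cmod (d h j) = sqrt (Y h) * t h j" if h: "h \<in> H" and j: "j \<in> I" for h j
  proof (cases "Y h = 0")
    \<comment> \<open>Here \<open>t h j = 0\<close> by the convention for division by zero, so it
      must be shown that \<open>d h j\<close> vanishes as well.\<close>
    case True
    have "cmod (d h j) powr r \<le> (\<Sum>j\<in>I. cmod (d h j) powr r)"
      using I j by (intro member_le_sum) auto
    also have "\<dots> \<le> 0" using d[OF h] True by simp
    finally have "cmod (d h j) = 0" by (simp add: powr_def split: if_splits)
    then show ?thesis using True by simp
  qed (use Y h in \<open>simp add: t_def\<close>)
  have tsum: "(\<Sum>j\<in>I. t h j powr r) \<le> 1" if h: "h \<in> H" for h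
  proof -
    have "(\<Sum>j\<in>I. t h j powr r) = (\<Sum>j\<in>I. cmod (d h j) powr r) / Y h powr (r / 2)"
      using Y[OF h] by (simp add: t_def powr_divide powr_half_sqrt[symmetric] powr_powr sum_divide_distrib)
    also have "\<dots> \<le> 1" using d[OF h] by (simp add: divide_le_eq_1)
    finally show ?thesis .
  qed
  have each: "cmod (\<Sum>h\<in>H. W h *\<^sub>R d h j) powr r \<le> S powr (r / 2) * (\<Sum>h\<in>H. W h * t h j powr r)"
    if j: "j \<in> I" for j
  proof -
    have "cmod (\<Sum>h\<in>H. W h *\<^sub>R d h j) \<le> (\<Sum>h\<in>H. W h * cmod (d h j))"
      by (rule order.trans[OF norm_sum]) (use W in \<open>simp add: sum_mono\<close>)
    also have "\<dots> = (\<Sum>h\<in>H. sqrt (W h * Y h) * (sqrt (W h) * t h j))"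
      using W Y j by (intro sum.cong) (auto simp: dt real_sqrt_mult)
    finally have "(cmod (\<Sum>h\<in>H. W h *\<^sub>R d h j))\<^sup>2 \<le> (\<Sum>h\<in>H. sqrt (W h * Y h) * (sqrt (W h) * t h j))\<^sup>2"
      by (intro power_mono) auto
    also have "\<dots> \<le> (\<Sum>h\<in>H. (sqrt (W h * Y h))\<^sup>2) * (\<Sum>h\<in>H. (sqrt (W h) * t h j)\<^sup>2)"
      by (rule Cauchy_Schwarz_ineq_sum)
    also have "\<dots> = S * (\<Sum>h\<in>H. W h * (t h j)\<^sup>2)"
      using W Y by (simp add: S_def power_mult_distrib)
    finally have *: "(cmod (\<Sum>h\<in>H. W h *\<^sub>R d h j))\<^sup>2 \<le> S * (\<Sum>h\<in>H. W h * (t h j)\<^sup>2)" .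
    have "cmod (\<Sum>h\<in>H. W h *\<^sub>R d h j) powr r \<le> (S * (\<Sum>h\<in>H. W h * (t h j)\<^sup>2)) powr (r / 2)"
      unfolding power2_powr_half[OF norm_ge_zero, symmetric] using * r by (intro powr_mono2) auto
    also have "\<dots> = S powr (r / 2) * (\<Sum>h\<in>H. W h * (t h j)\<^sup>2) powr (r / 2)"
      using S W by (simp add: powr_mult)
    also have "\<dots> \<le> S powr (r / 2) * (\<Sum>h\<in>H. W h * ((t h j)\<^sup>2) powr (r / 2))"
      using W H r by (intro mult_left_mono powr_sum_le) auto
    also have "\<dots> = S powr (r / 2) * (\<Sum>h\<in>H. W h * t h j powr r)"
      using t0 by (simp add: power2_powr_half)
    finally show ?thesis .
  qed
  have "(\<Sum>j\<in>I. cmod (\<Sum>h\<in>H. W h *\<^sub>R d h j) powr r) \<le> (\<Sum>j\<in>I. S powr (r / 2) * (\<Sum>h\<in>H. W h * t h j powr r))"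
    by (intro sum_mono each)
  also have "\<dots> = S powr (r / 2) * (\<Sum>h\<in>H. W h * (\<Sum>j\<in>I. t h j powr r))"
    by (simp only: sum_distrib_left) (rule sum.swap)
  also have "\<dots> \<le> S powr (r / 2) * (\<Sum>h\<in>H. W h * 1)"
    using W tsum by (intro mult_left_mono sum_mono) auto
  finally show ?thesis using W by (simp add: S_def)
qed

section \<open>Jumps exceeding a fraction of the running maximum\<close>

primrec running_max :: "(nat \<Rightarrow> 'a::real_normed_vector) \<Rightarrow> nat \<Rightarrow> real" where
  "running_max v 0 = norm (v 0)"
| "running_max v (Suc i) = max (running_max v i) (norm (v (Suc i)))"

text \<open>The value at the last stopping time up to \<open>i\<close>, where a new stopping time
  occurs once the sequence is at distance at least \<open>\<theta>\<close> times its running maximum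
  from the previous anchor. The recursion avoids naming the stopping times.\<close>

primrec anchor :: "real \<Rightarrow> (nat \<Rightarrow> 'a::real_normed_vector) \<Rightarrow> nat \<Rightarrow> 'a" where
  "anchor \<theta> v 0 = v 0"
| "anchor \<theta> v (Suc i) = (if \<theta> * running_max v (Suc i) \<le> norm (v (Suc i) - anchor \<theta> v i)
     then v (Suc i) else anchor \<theta> v i)"

primrec jump_energy :: "real \<Rightarrow> (nat \<Rightarrow> 'a::real_normed_vector) \<Rightarrow> nat \<Rightarrow> real" where
  "jump_energy \<theta> v 0 = 0"
| "jump_energy \<theta> v (Suc i) = jump_energy \<theta> v i + (norm (anchor \<theta> v (Suc i) - anchor \<theta> v i))\<^sup>2"

text \<open>This and the next two lemmas say that the quantities are adapted: extending a path by a
  vertex leaves their earlier values unchanged.\<close>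

lemma running_max_cong: "(\<And>j. j \<le> i \<Longrightarrow> v j = w j) \<Longrightarrow> running_max v i = running_max w i"
  by (induction i) auto

lemma anchor_cong: "(\<And>j. j \<le> i \<Longrightarrow> v j = w j) \<Longrightarrow> anchor \<theta> v i = anchor \<theta> w i"
proof (induction i)
  case (Suc i)
  then have "anchor \<theta> v i = anchor \<theta> w i" by auto
  moreover have "running_max v (Suc i) = running_max w (Suc i)" by (rule running_max_cong) (rule Suc.prems)
  ultimately show ?case using Suc.prems[of "Suc i"] by (simp only: anchor.simps)
qed simp

lemma jump_energy_cong: "(\<And>j. j \<le> i \<Longrightarrow> v j = w j) \<Longrightarrow> jump_energy \<theta> v i = jump_energy \<theta> w i"
proof (induction i)
  case (Suc i)
  then have "jump_energy \<theta> v i = jump_energy \<theta> w i" by auto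
  then show ?case
    using anchor_cong[of "Suc i" v w \<theta>] anchor_cong[of i v w \<theta>] Suc.prems by (simp del: anchor.simps)
qed simp

lemma running_max_ge: "j \<le> i \<Longrightarrow> norm (v j) \<le> running_max v i"
  by (induction i) (auto simp: le_Suc_eq)

lemma running_max_nonneg: "0 \<le> running_max v i"
  using running_max_ge[of 0 i v] norm_ge_zero[of "v 0"] by linarith

lemma running_max_mono: "i \<le> j \<Longrightarrow> running_max v i \<le> running_max v j"
  by (induction j) (auto simp: le_Suc_eq)

lemma jump_energy_mono: "i \<le> j \<Longrightarrow> jump_energy \<theta> v i \<le> jump_energy \<theta> v j"
  by (induction j) (auto simp: le_Suc_eq add_increasing2)

lemma jump_energy_nonneg: "0 \<le> jump_energy \<theta> v i"
  using jump_energy_mono[of 0 i] by simp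

lemma anchor_near:
  assumes "0 \<le> \<theta>"
  shows "norm (v i - anchor \<theta> v i) \<le> \<theta> * running_max v i"
  using assms running_max_nonneg[of v] by (cases i) (auto simp del: running_max.simps)

text \<open>Take for \<open>\<mu>\<close> the running maximum at the last jump after
  \<open>a\<close>. That jump has size at least \<open>\<theta> * \<mu>\<close>. Afterwards the
  sequence stays within \<open>\<theta>\<close> times its running maximum of an anchor of norm at
  most \<open>\<mu>\<close>, so the maximum cannot grow beyond
  \<open>\<mu> / (1 - \<theta>)\<close>.\<close>

lemma anchor_moved:
  assumes \<theta>: "0 \<le> \<theta>" and "a \<le> b"
  shows "anchor \<theta> v b = anchor \<theta> v a \<or>
    (\<exists>\<mu>\<ge>0. norm (anchor \<theta> v b) \<le> \<mu> \<and> (1 - \<theta>) * running_max v b \<le> \<mu>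
      \<and> (\<theta> * \<mu>)\<^sup>2 \<le> jump_energy \<theta> v b - jump_energy \<theta> v a)"
  using \<open>a \<le> b\<close>
proof (induction b rule: dec_induct)
  case (step b)
  let ?m = "running_max v (Suc b)"
  show ?case
  proof (cases "\<theta> * ?m \<le> norm (v (Suc b) - anchor \<theta> v b)")
    case True
    then have A: "anchor \<theta> v (Suc b) = v (Suc b)" by simp
    have m0: "0 \<le> ?m" by (rule running_max_nonneg)
    have "(\<theta> * ?m)\<^sup>2 \<le> (norm (v (Suc b) - anchor \<theta> v b))\<^sup>2"
      using True \<theta> m0 by (intro power_mono) auto
    also have "\<dots> = jump_energy \<theta> v (Suc b) - jump_energy \<theta> v b"
      unfolding jump_energy.simps A by simp
    also have "\<dots> \<le> jump_energy \<theta> v (Suc b) - jump_energy \<theta> v a"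
      using jump_energy_mono[of a b \<theta> v] step by simp
    finally have "(\<theta> * ?m)\<^sup>2 \<le> jump_energy \<theta> v (Suc b) - jump_energy \<theta> v a" .
    moreover have "norm (anchor \<theta> v (Suc b)) \<le> ?m" unfolding A by (rule running_max_ge) simp
    moreover have "(1 - \<theta>) * ?m \<le> ?m" using \<theta> m0 by (simp add: algebra_simps)
    ultimately show ?thesis using m0 by blast
  next
    case False
    then have A: "anchor \<theta> v (Suc b) = anchor \<theta> v b" by simp
    then have J: "jump_energy \<theta> v (Suc b) = jump_energy \<theta> v b" by (simp del: anchor.simps)
    from step.IH show ?thesis
    proof
      assume "\<exists>\<mu>\<ge>0. norm (anchor \<theta> v b) \<le> \<mu> \<and> (1 - \<theta>) * running_max v b \<le> \<mu>
        \<and> (\<theta> * \<mu>)\<^sup>2 \<le> jump_energy \<theta> v b - jump_energy \<theta> v a"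
      then obtain \<mu> where \<mu>: "\<mu> \<ge> 0" "norm (anchor \<theta> v b) \<le> \<mu>" "(1 - \<theta>) * running_max v b \<le> \<mu>"
        "(\<theta> * \<mu>)\<^sup>2 \<le> jump_energy \<theta> v b - jump_energy \<theta> v a" by blast
      have "norm (v (Suc b)) \<le> norm (v (Suc b) - anchor \<theta> v b) + norm (anchor \<theta> v b)"
        using norm_triangle_ineq[of "v (Suc b) - anchor \<theta> v b" "anchor \<theta> v b"] by simp
      also have "\<dots> \<le> \<theta> * ?m + \<mu>" using False \<mu> by linarith
      finally have "(1 - \<theta>) * ?m \<le> \<mu>"
        using \<mu>(3) by (cases "?m = norm (v (Suc b))") (auto simp: algebra_simps max_def split: if_splits)
      then show ?thesis using \<mu> unfolding A J by blast
    qed (use A in simp)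
  qed
qed simp

text \<open>If the anchors at \<open>a\<close> and \<open>b\<close> agreed, two uses of
  \<open>anchor_near\<close> would bound the increment by \<open>2 * \<theta>\<close> times the
  maximum. Hence a jump occurred in between, and since \<open>\<theta> \<le> 1 / 2\<close> the
  increment is at most \<open>8 * \<theta> * \<mu>\<close>; this gives 64.\<close>

lemma increment_le_jump_energy:
  assumes \<theta>: "0 < \<theta>" "\<theta> \<le> 1 / 2" and ab: "a \<le> b"
    and d: "2 * \<theta> * running_max v b < norm (v b - v a)" "norm (v b - v a) \<le> 4 * \<theta> * running_max v b"
  shows "(norm (v b - v a))\<^sup>2 \<le> 64 * (jump_energy \<theta> v b - jump_energy \<theta> v a)"
proof -
  let ?m = "running_max v b"
  have m0: "0 \<le> ?m" by (rule running_max_nonneg)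
  have "anchor \<theta> v b \<noteq> anchor \<theta> v a"
  proof
    assume eq: "anchor \<theta> v b = anchor \<theta> v a"
    have "norm (v b - v a) \<le> norm (v b - anchor \<theta> v b) + norm (v a - anchor \<theta> v a)"
      using norm_triangle_ineq4[of "v b - anchor \<theta> v b" "v a - anchor \<theta> v a"] eq by simp
    also have "\<dots> \<le> \<theta> * ?m + \<theta> * running_max v a"
      using \<theta> by (intro add_mono anchor_near) auto
    also have "\<dots> \<le> \<theta> * ?m + \<theta> * ?m"
      using \<theta> ab running_max_mono[of a b v] by simp
    finally show False using d by simp
  qed
  then obtain \<mu> where \<mu>: "\<mu> \<ge> 0" "(1 - \<theta>) * ?m \<le> \<mu>"
      "(\<theta> * \<mu>)\<^sup>2 \<le> jump_energy \<theta> v b - jump_energy \<theta> v a"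
    using anchor_moved[of \<theta> a b v] \<theta> ab by auto
  have "(1 / 2) * ?m \<le> (1 - \<theta>) * ?m" using \<theta> m0 by (intro mult_right_mono) auto
  then have "?m \<le> 2 * \<mu>" using \<mu> by linarith
  then have "4 * \<theta> * ?m \<le> 4 * \<theta> * (2 * \<mu>)" using \<theta> by (intro mult_left_mono) auto
  then have "norm (v b - v a) \<le> 8 * (\<theta> * \<mu>)" using d by linarith
  then have "(norm (v b - v a))\<^sup>2 \<le> (8 * (\<theta> * \<mu>))\<^sup>2" by (intro power_mono) auto
  also have "\<dots> = 64 * (\<theta> * \<mu>)\<^sup>2" by (simp add: power_mult_distrib)
  finally show ?thesis using \<mu> by simp
qed

text \<open>Scale \<open>p = 1\<close> starts at \<open>4 * (1 / 2) * m = 2 * m\<close>, the largest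
  increment possible for a sequence bounded by \<open>m\<close>. Anything not caught by the scales
  up to \<open>P\<close> is tiny.\<close>

lemma dyadic_scale_cases:
  fixes d m :: real
  assumes "1 \<le> P" "d \<le> 2 * m"
  shows "d \<le> 4 * (1 / 2) ^ P * m \<or> (\<exists>p\<in>{1..P}. 2 * (1 / 2) ^ p * m < d \<and> d \<le> 4 * (1 / 2) ^ p * m)"
  using assms(1)
proof (induction P rule: dec_induct)
  case (step P)
  then show ?case
  proof (cases "d \<le> 4 * (1 / 2) ^ P * m")
    case True
    then have "P \<in> {1..Suc P} \<and> 2 * (1 / 2) ^ P * m < d \<and> d \<le> 4 * (1 / 2) ^ P * m"
      if "\<not> d \<le> 4 * (1 / 2) ^ Suc P * m" using that step by simp
    then show ?thesis by blast
  qed force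
qed (use assms in simp)

text \<open>Bounds the square of the \<open>r\<close>-variation. The weight of scale
  \<open>p\<close> comes from writing \<open>d powr r = d powr (r - 2) * d^2\<close> for an
  increment \<open>d\<close> of size about \<open>(1 / 2) ^ p\<close> times the maximum.\<close>

definition path_bound :: "real \<Rightarrow> nat \<Rightarrow> (nat \<Rightarrow> 'a::real_normed_vector) \<Rightarrow> nat \<Rightarrow> real" where
  "path_bound r P v K = (running_max v K)\<^sup>2
     + (\<Sum>p=1..P. 64 * (4 * (1 / 2) ^ p) powr (r - 2) * jump_energy ((1 / 2) ^ p) v K)"

lemma path_bound_nonneg: "0 \<le> path_bound r P v K"
  unfolding path_bound_def by (intro add_nonneg_nonneg sum_nonneg mult_nonneg_nonneg jump_energy_nonneg) auto

text \<open>Every increment either belongs to a scale \<open>p \<le> P\<close>, where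
  \<open>increment_le_jump_energy\<close> applies, or is below the finest scale; by the choice of
  \<open>P\<close>, at most \<open>K\<close> of the latter contribute no more than
  \<open>M powr r\<close> in all.\<close>

lemma path_variation:
  fixes v :: "nat \<Rightarrow> complex"
  assumes r: "2 < r" and P: "1 \<le> P" "real K * (4 * (1 / 2) ^ P) powr r \<le> 1"
  shows "variation_le r v {..K} (path_bound r P v K)"
  unfolding variation_le_def
proof (intro conjI path_bound_nonneg allI impI)
  fix J :: nat and k :: "nat \<Rightarrow> nat"
  assume k: "mono_on {0..J} k" "k ` {0..J} \<subseteq> {..K}"
  define M where "M = running_max v K"
  define c where "c p = 64 * (4 * (1 / 2) ^ p) powr (r - 2)" for p :: nat
  define e where "e = (4 * (1 / 2) ^ P) powr r * M powr r"
  define S where "S i = (\<Sum>p=1..P. M powr (r - 2) * c p * jump_energy ((1 / 2) ^ p) v i)" for i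
  \<comment> \<open>The control function: weighted jump energies, plus \<open>e\<close> per unit of
    time to pay for increments below the finest scale.\<close>
  define w where "w i = S i + real i * e" for i
  have M: "0 \<le> M" by (simp add: M_def running_max_nonneg)
  have c: "0 \<le> c p" for p by (simp add: c_def)
  have e: "0 \<le> e" by (simp add: e_def)
  have S_mono: "S a \<le> S b" if "a \<le> b" for a b
    unfolding S_def using that M c by (intro sum_mono mult_left_mono jump_energy_mono) auto
  have S0: "S 0 = 0" by (simp add: S_def)
  have ctl: "cmod (v a - v b) powr r \<le> w b - w a" if ab: "a \<in> {..K}" "b \<in> {..K}" "a \<le> b" for a b
  proof (cases "a = b")
    case True
    then show ?thesis using r by simp
  next
    case False
    define d where "d = norm (v b - v a)"
    define m where "m = running_max v b"
    have m: "m \<le> M" "0 \<le> m" using ab by (auto simp: m_def M_def running_max_mono running_max_nonneg)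
    have "d \<le> norm (v b) + norm (v a)" unfolding d_def by (rule norm_triangle_ineq4)
    also have "\<dots> \<le> m + m" using ab unfolding m_def by (intro add_mono running_max_ge) auto
    finally have "d \<le> 2 * m" by simp
    then consider "d \<le> 4 * (1 / 2) ^ P * m"
      | p where "p \<in> {1..P}" "2 * (1 / 2) ^ p * m < d" "d \<le> 4 * (1 / 2) ^ p * m"
      using dyadic_scale_cases[OF P(1)] by blast
    then have "d powr r \<le> w b - w a"
    proof cases
      case 1
      have "d \<le> 4 * (1 / 2) ^ P * M"
        using m by (intro order.trans[OF 1] mult_left_mono) auto
      then have "d powr r \<le> (4 * (1 / 2) ^ P * M) powr r" using r by (intro powr_mono2) (auto simp: d_def)
      also have "\<dots> = e" using M by (simp add: e_def powr_mult)
      also have "e * 1 \<le> e * (real b - real a)" using False ab e by (intro mult_left_mono) auto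
      finally show ?thesis using S_mono[of a b] ab by (simp add: w_def algebra_simps)
    next
      case 2
      let ?D = "jump_energy ((1 / 2) ^ p) v b - jump_energy ((1 / 2) ^ p) v a"
      have "(1 / 2 :: real) ^ p \<le> (1 / 2) ^ 1" using 2 by (intro power_decreasing) auto
      then have sq: "d\<^sup>2 \<le> 64 * ?D"
        unfolding d_def by (intro increment_le_jump_energy) (use 2 ab in \<open>auto simp: d_def m_def\<close>)
      have d0: "0 < d" using 2 m by (metis le_less_trans mult_nonneg_nonneg zero_le_numeral zero_le_power zero_le_divide_1_iff)
      have "d powr r = d powr (r - 2) * d\<^sup>2"
        using d0 powr_add[of d "r - 2" 2] by (simp add: powr_numeral)
      also have "\<dots> \<le> (4 * (1 / 2) ^ p * M) powr (r - 2) * (64 * ?D)"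
      proof (intro mult_mono sq powr_mono2)
        show "d \<le> 4 * (1 / 2) ^ p * M" using m 2 by (intro order.trans[OF 2(3)] mult_left_mono) auto
      qed (use r d0 in auto)
      also have "\<dots> = M powr (r - 2) * c p * ?D" using M by (simp add: c_def powr_mult mult_ac)
      also have "\<dots> \<le> (\<Sum>p=1..P. M powr (r - 2) * c p * (jump_energy ((1 / 2) ^ p) v b - jump_energy ((1 / 2) ^ p) v a))"
        using 2 c M jump_energy_mono[OF ab(3)]
        by (intro member_le_sum[where f = "\<lambda>p. M powr (r - 2) * c p * (jump_energy ((1 / 2) ^ p) v b - jump_energy ((1 / 2) ^ p) v a)"])
          (auto intro!: mult_nonneg_nonneg)
      also have "\<dots> = S b - S a" by (simp add: S_def right_diff_distrib sum_subtractf)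
      also have "\<dots> \<le> w b - w a" using e ab by (simp add: w_def mult_right_mono)
      finally show ?thesis .
    qed
    then show ?thesis by (simp add: d_def norm_minus_commute)
  qed
  define Y where "Y = path_bound r P v K"
  have Y: "Y = M\<^sup>2 + (\<Sum>p=1..P. c p * jump_energy ((1 / 2) ^ p) v K)"
    by (simp add: Y_def path_bound_def M_def c_def)
  have sum0: "0 \<le> (\<Sum>p=1..P. c p * jump_energy ((1 / 2) ^ p) v K)"
    by (intro sum_nonneg mult_nonneg_nonneg jump_energy_nonneg c)
  have "(\<Sum>j=1..J. cmod (v (k (j - 1)) - v (k j)) powr r) \<le> w (k J) - w (k 0)"
    by (rule sum_le_control[where d = "\<lambda>a b. cmod (v a - v b) powr r", OF k ctl])
  also have "\<dots> \<le> w K"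
  proof -
    have "k J \<le> K" using k(2) by (auto simp: image_subset_iff)
    then have "w (k J) \<le> w K" unfolding w_def using e by (intro add_mono S_mono mult_right_mono) auto
    moreover have "0 \<le> w (k 0)" using S_mono[of 0 "k 0"] S0 e by (simp add: w_def)
    ultimately show ?thesis by simp
  qed
  also have "\<dots> \<le> M powr (r - 2) * Y"
  proof -
    have "real K * e \<le> M powr r"
      using P(2) mult_right_mono[OF P(2), of "M powr r"] by (simp add: e_def mult_ac)
    also have "\<dots> = M powr (r - 2) * M\<^sup>2"
      using M powr_add[of M "r - 2" 2] by (cases "M = 0") (auto simp: powr_numeral)
    finally show ?thesis
      unfolding w_def Y S_def by (simp add: sum_distrib_left distrib_left mult_ac)
  qed
  \<comment> \<open>Because \<open>M\<^sup>2\<close> is one of the nonnegative summands of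
    \<open>Y\<close>.\<close>
  also have "\<dots> \<le> Y powr ((r - 2) / 2) * Y"
  proof (rule mult_right_mono)
    have "M powr (r - 2) = (M\<^sup>2) powr ((r - 2) / 2)"
      using M by (simp only: power2_powr_half)
    also have "\<dots> \<le> Y powr ((r - 2) / 2)" using r sum0 by (intro powr_mono2) (auto simp: Y)
    finally show "M powr (r - 2) \<le> Y powr ((r - 2) / 2)" .
  qed (simp add: Y_def path_bound_nonneg)
  also have "\<dots> = Y powr (r / 2)"
    using path_bound_nonneg[of r P v K] powr_add[of Y "(r - 2) / 2" 1]
    by (cases "Y = 0") (auto simp: Y_def[symmetric] diff_divide_distrib)
  finally show "(\<Sum>j=1..J. cmod (v (k (j - 1)) - v (k j)) powr r) \<le> path_bound r P v K powr (r / 2)"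
    by (simp add: Y_def)
qed

section \<open>Stability rules for variation bounds\<close>

lemma variation_le_nonneg: "variation_le r a Z W \<Longrightarrow> 0 \<le> W"
  by (simp add: variation_le_def)

lemma variation_leD:
  fixes J :: nat
  assumes "variation_le r a Z W" "mono_on {0..J} k" "k ` {0..J} \<subseteq> Z"
  shows "(\<Sum>j=1..J. cmod (a (k (j - 1)) - a (k j)) powr r) \<le> W powr (r / 2)"
  using assms by (simp add: variation_le_def)

lemma variation_leI:
  assumes "0 \<le> W"
    and "\<And>(J::nat) k. mono_on {0..J} k \<Longrightarrow> k ` {0..J} \<subseteq> Z
      \<Longrightarrow> (\<Sum>j=1..J. cmod (a (k (j - 1)) - a (k j)) powr r) \<le> W powr (r / 2)"
  shows "variation_le r a Z W"
  using assms by (simp add: variation_le_def)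

lemma variation_le_cong:
  assumes "variation_le r a Z W" "\<And>k. k \<in> Z \<Longrightarrow> a k = b k"
  shows "variation_le r b Z W"
proof (rule variation_leI)
  fix J :: nat and k assume k: "mono_on {0..J} k" "k ` {0..J} \<subseteq> Z"
  have "(\<Sum>j=1..J. cmod (b (k (j - 1)) - b (k j)) powr r) = (\<Sum>j=1..J. cmod (a (k (j - 1)) - a (k j)) powr r)"
    using k(2) by (intro sum.cong) (auto simp: assms(2) image_subset_iff)
  then show "(\<Sum>j=1..J. cmod (b (k (j - 1)) - b (k j)) powr r) \<le> W powr (r / 2)"
    using variation_leD[OF assms(1) k] by simp
qed (use variation_le_nonneg[OF assms(1)] in simp)

lemma variation_le_comp_mono:
  assumes "variation_le r a Z W" "mono_on Z' g" "g ` Z' \<subseteq> Z"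
  shows "variation_le r (\<lambda>k. a (g k)) Z' W"
proof (rule variation_leI)
  fix J :: nat and k assume k: "mono_on {0..J} k" "k ` {0..J} \<subseteq> Z'"
  have "mono_on {0..J} (\<lambda>j. g (k j))"
  proof (rule monotone_onI)
    fix x y assume "x \<in> {0..J}" "y \<in> {0..J}" "x \<le> y"
    then show "g (k x) \<le> g (k y)"
      using k(2) monotone_onD[OF k(1), of x y] by (intro monotone_onD[OF assms(2)]) auto
  qed
  moreover have "(\<lambda>j. g (k j)) ` {0..J} \<subseteq> Z" using k(2) assms(3) by blast
  ultimately show "(\<Sum>j=1..J. cmod (a (g (k (j - 1))) - a (g (k j))) powr r) \<le> W powr (r / 2)"
    by (rule variation_leD[OF assms(1)])
qed (use variation_le_nonneg[OF assms(1)] in simp)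

text \<open>Reading a sequence backwards permutes its increments. This serves the reversals
  \<open>K - k\<close> of time and \<open>n - k\<close> of radius.\<close>

lemma variation_le_comp_antimono:
  assumes "variation_le r a Z W" "antimono_on Z' g" "g ` Z' \<subseteq> Z"
  shows "variation_le r (\<lambda>k. a (g k)) Z' W"
proof (rule variation_leI)
  fix J :: nat and k assume k: "mono_on {0..J} k" "k ` {0..J} \<subseteq> Z'"
  define l where "l j = g (k (J - j))" for j
  have "mono_on {0..J} l"
    unfolding l_def
  proof (rule monotone_onI)
    fix x y assume "x \<in> {0..J}" "y \<in> {0..J}" "x \<le> y"
    then show "g (k (J - x)) \<le> g (k (J - y))"
      using k(2) monotone_onD[OF k(1), of "J - y" "J - x"] by (intro monotone_onD[OF assms(2)]) auto
  qed
  moreover have "l ` {0..J} \<subseteq> Z"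
  proof -
    have "g (k i) \<in> Z" if "i \<le> J" for i using k(2) assms(3) that by (auto simp: image_subset_iff)
    then show ?thesis by (auto simp: l_def)
  qed
  ultimately have "(\<Sum>j=1..J. cmod (a (l (j - 1)) - a (l j)) powr r) \<le> W powr (r / 2)"
    by (rule variation_leD[OF assms(1)])
  also have "(\<Sum>j=1..J. cmod (a (l (j - 1)) - a (l j)) powr r)
      = (\<Sum>j=1..J. cmod (a (g (k (j - 1))) - a (g (k j))) powr r)"
    by (intro sum.reindex_bij_witness[where i = "\<lambda>j. J + 1 - j" and j = "\<lambda>j. J + 1 - j"])
      (auto simp: l_def norm_minus_commute Suc_diff_le)
  finally show "(\<Sum>j=1..J. cmod (a (g (k (j - 1))) - a (g (k j))) powr r) \<le> W powr (r / 2)" .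
qed (use variation_le_nonneg[OF assms(1)] in simp)

text \<open>The bounds stand for squared variations and average linearly, so that conditional
  expectations of them can later be summed over the endpoint.\<close>

lemma variation_le_average:
  assumes H: "finite H" and W: "\<And>h. h \<in> H \<Longrightarrow> 0 \<le> W h" "(\<Sum>h\<in>H. W h) = 1"
    and a: "\<And>h. h \<in> H \<Longrightarrow> variation_le r (a h) Z (Y h)" and r: "2 \<le> r"
  shows "variation_le r (\<lambda>k. \<Sum>h\<in>H. W h *\<^sub>R a h k) Z (\<Sum>h\<in>H. W h * Y h)"
proof (rule variation_leI)
  show "0 \<le> (\<Sum>h\<in>H. W h * Y h)"
    using W variation_le_nonneg[OF a] by (intro sum_nonneg mult_nonneg_nonneg) auto
  fix J :: nat and k assume k: "mono_on {0..J} k" "k ` {0..J} \<subseteq> Z"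
  have "(\<Sum>j\<in>{1..J}. cmod (\<Sum>h\<in>H. W h *\<^sub>R (a h (k (j - 1)) - a h (k j))) powr r)
      \<le> (\<Sum>h\<in>H. W h * Y h) powr (r / 2)"
    by (rule sum_average_powr_le) (use H W r variation_le_nonneg[OF a] variation_leD[OF a k] in auto)
  then show "(\<Sum>j=1..J. cmod ((\<Sum>h\<in>H. W h *\<^sub>R a h (k (j - 1))) - (\<Sum>h\<in>H. W h *\<^sub>R a h (k j))) powr r)
      \<le> (\<Sum>h\<in>H. W h * Y h) powr (r / 2)"
    by (simp add: scaleR_diff_right sum_subtractf)
qed

lemma powr_add_le:
  fixes x y r :: real
  assumes "0 \<le> x" "0 \<le> y" "0 \<le> r"
  shows "(x + y) powr r \<le> 2 powr r * (x powr r + y powr r)"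
proof -
  have "(x + y) powr r \<le> (2 * max x y) powr r" using assms by (intro powr_mono2) auto
  also have "\<dots> = 2 powr r * max x y powr r" using assms by (simp add: powr_mult)
  also have "max x y powr r \<le> x powr r + y powr r" by (simp add: max_def)
  finally show ?thesis by simp
qed

text \<open>The constant 16 serves all \<open>r\<close>, since
  \<open>16 powr (r / 2) = 2 powr (2 * r)\<close> absorbs the factor
  \<open>2 powr (r + 1)\<close>.\<close>

lemma variation_le_add:
  assumes a: "variation_le r a Z V" and b: "variation_le r b Z W" and r: "2 \<le> r"
  shows "variation_le r (\<lambda>k. a k + b k) Z (16 * (V + W))"
proof (rule variation_leI)
  have V: "0 \<le> V" and W: "0 \<le> W" using a b by (auto simp: variation_le_nonneg)
  then show "0 \<le> 16 * (V + W)" by simp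
  fix J :: nat and k assume k: "mono_on {0..J} k" "k ` {0..J} \<subseteq> Z"
  have "(\<Sum>j=1..J. cmod (a (k (j - 1)) + b (k (j - 1)) - (a (k j) + b (k j))) powr r)
    \<le> (\<Sum>j=1..J. 2 powr r * (cmod (a (k (j - 1)) - a (k j)) powr r + cmod (b (k (j - 1)) - b (k j)) powr r))"
  proof (rule sum_mono)
    fix j
    have "cmod (a (k (j - 1)) + b (k (j - 1)) - (a (k j) + b (k j)))
        \<le> cmod (a (k (j - 1)) - a (k j)) + cmod (b (k (j - 1)) - b (k j))"
      using norm_triangle_ineq[of "a (k (j - 1)) - a (k j)" "b (k (j - 1)) - b (k j)"] by (simp add: algebra_simps)
    then have "cmod (a (k (j - 1)) + b (k (j - 1)) - (a (k j) + b (k j))) powr r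
        \<le> (cmod (a (k (j - 1)) - a (k j)) + cmod (b (k (j - 1)) - b (k j))) powr r"
      using r by (intro powr_mono2) auto
    also have "\<dots> \<le> 2 powr r * (cmod (a (k (j - 1)) - a (k j)) powr r + cmod (b (k (j - 1)) - b (k j)) powr r)"
      using r by (intro powr_add_le) auto
    finally show "cmod (a (k (j - 1)) + b (k (j - 1)) - (a (k j) + b (k j))) powr r
      \<le> 2 powr r * (cmod (a (k (j - 1)) - a (k j)) powr r + cmod (b (k (j - 1)) - b (k j)) powr r)" .
  qed
  also have "\<dots> = 2 powr r * ((\<Sum>j=1..J. cmod (a (k (j - 1)) - a (k j)) powr r)
      + (\<Sum>j=1..J. cmod (b (k (j - 1)) - b (k j)) powr r))"
    by (simp only: sum_distrib_left sum.distrib distrib_left)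
  also have "\<dots> \<le> 2 powr r * (V powr (r / 2) + W powr (r / 2))"
    by (intro mult_left_mono add_mono variation_leD[OF a k] variation_leD[OF b k]) auto
  also have "\<dots> \<le> 2 powr r * ((V + W) powr (r / 2) + (V + W) powr (r / 2))"
    using V W r by (intro mult_left_mono add_mono powr_mono2) auto
  also have "\<dots> = 2 powr (r + 1) * (V + W) powr (r / 2)" by (simp add: powr_add)
  also have "\<dots> \<le> 16 powr (r / 2) * (V + W) powr (r / 2)"
  proof (rule mult_right_mono)
    have "(16::real) powr (r / 2) = 2 powr (2 * r)"
      using powr_powr[of "2::real" 4 "r / 2"] by simp
    then show "2 powr (r + 1) \<le> (16::real) powr (r / 2)" using r by simp
  qed simp
  also have "\<dots> = (16 * (V + W)) powr (r / 2)" by (rule powr_mult[symmetric])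
  finally show "(\<Sum>j=1..J. cmod (a (k (j - 1)) + b (k (j - 1)) - (a (k j) + b (k j))) powr r)
    \<le> (16 * (V + W)) powr (r / 2)" .
qed

text \<open>A monotone sequence crosses the threshold \<open>N\<close> at most once.\<close>

lemma variation_le_step:
  fixes c d :: complex
  assumes r: "2 \<le> r"
  shows "variation_le r (\<lambda>k. if k \<le> N then c else d) Z ((cmod (c - d))\<^sup>2)"
proof (rule variation_leI)
  fix J :: nat and k :: "nat \<Rightarrow> nat" assume k: "mono_on {0..J} k" "k ` {0..J} \<subseteq> Z"
  let ?a = "\<lambda>k. if k \<le> N then c else d"
  let ?w = "\<lambda>k. if k \<le> N then 0 else cmod (c - d) powr r"
  have "(\<Sum>j=1..J. cmod (?a (k (j - 1)) - ?a (k j)) powr r) \<le> ?w (k J) - ?w (k 0)"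
    by (rule sum_le_control[where d = "\<lambda>x y. cmod (?a x - ?a y) powr r" and w = ?w, OF k]) (use r in auto)
  also have "\<dots> \<le> cmod (c - d) powr r" by auto
  also have "\<dots> = (cmod (c - d))\<^sup>2 powr (r / 2)" by (simp add: power2_powr_half)
  finally show "(\<Sum>j=1..J. cmod (?a (k (j - 1)) - ?a (k j)) powr r) \<le> (cmod (c - d))\<^sup>2 powr (r / 2)" .
qed simp

text \<open>A control of squared increments suffices for \<open>r \<ge> 2\<close>: the remaining
  power \<open>r - 2\<close> of each increment is bounded by
  \<open>W powr ((r - 2) / 2)\<close>.\<close>

lemma variation_le_control:
  fixes w :: "nat \<Rightarrow> real"
  assumes r: "2 \<le> r" and W: "\<And>a b. a \<in> Z \<Longrightarrow> b \<in> Z \<Longrightarrow> a \<le> b \<Longrightarrow> w b - w a \<le> W"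
    and ctl: "\<And>a b. a \<in> Z \<Longrightarrow> b \<in> Z \<Longrightarrow> a \<le> b \<Longrightarrow> (cmod (h b - h a))\<^sup>2 \<le> w b - w a"
    and "Z \<noteq> {}"
  shows "variation_le r h Z W"
proof (rule variation_leI)
  obtain z where "z \<in> Z" using assms(4) by blast
  then show W0: "0 \<le> W" using W[of z z] by simp
  fix J :: nat and k assume k: "mono_on {0..J} k" "k ` {0..J} \<subseteq> Z"
  have "(\<Sum>j=1..J. cmod (h (k (j - 1)) - h (k j)) powr r)
      \<le> W powr ((r - 2) / 2) * w (k J) - W powr ((r - 2) / 2) * w (k 0)"
  proof (rule sum_le_control[where d = "\<lambda>x y. cmod (h x - h y) powr r" and w = "\<lambda>x. W powr ((r - 2) / 2) * w x", OF k])
    fix a b assume ab: "a \<in> Z" "b \<in> Z" "a \<le> b"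
    have sq: "(cmod (h a - h b))\<^sup>2 \<le> w b - w a" using ctl[OF ab] by (simp add: norm_minus_commute)
    have "cmod (h a - h b) powr r = cmod (h a - h b) powr (r - 2) * (cmod (h a - h b))\<^sup>2"
      using powr_add[of "cmod (h a - h b)" "r - 2" 2] by (cases "h a = h b") (auto simp: powr_numeral)
    also have "cmod (h a - h b) powr (r - 2) = (cmod (h a - h b))\<^sup>2 powr ((r - 2) / 2)"
      by (simp only: power2_powr_half norm_ge_zero)
    also have "\<dots> * (cmod (h a - h b))\<^sup>2 \<le> W powr ((r - 2) / 2) * (w b - w a)"
      using sq W[OF ab] r by (intro mult_mono powr_mono2) auto
    finally show "cmod (h a - h b) powr r \<le> W powr ((r - 2) / 2) * w b - W powr ((r - 2) / 2) * w a"
      by (simp add: right_diff_distrib)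
  qed
  also have "\<dots> = W powr ((r - 2) / 2) * (w (k J) - w (k 0))" by (simp add: right_diff_distrib)
  also have "\<dots> \<le> W powr ((r - 2) / 2) * W"
    using k(2) by (intro mult_left_mono W monotone_onD[OF k(1)]) (auto simp: image_subset_iff)
  also have "\<dots> = W powr (r / 2)"
    using W0 powr_add[of W "(r - 2) / 2" 1] by (cases "W = 0") (auto simp: diff_divide_distrib)
  finally show "(\<Sum>j=1..J. cmod (h (k (j - 1)) - h (k j)) powr r) \<le> W powr (r / 2)" .
qed

lemma variation_nonneg:
  assumes "finite Z" "Z \<noteq> {}"
  shows "0 \<le> variation r a Z"
proof -
  have "variation r a Z \<in> variation_sums r a Z"
    unfolding variation_def using assms by (intro Max_in finite_variation_sums variation_sums_nonempty)
  then show ?thesis by (auto simp: variation_sums_def)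
qed

lemma variation_le_imp_variation:
  assumes a: "variation_le r a Z W" and Z: "finite Z" "Z \<noteq> {}" and r: "0 < r"
  shows "(variation r a Z)\<^sup>2 \<le> W"
proof -
  have le: "v \<le> sqrt W" if v: "v \<in> variation_sums r a Z" for v
  proof -
    obtain J :: nat and k where k: "strict_mono_on {0..J} k" "k ` {0..J} \<subseteq> Z"
      and v: "v = (\<Sum>j=1..J. cmod (a (k (j - 1)) - a (k j)) powr r) powr (1 / r)"
      using v unfolding variation_sums_def by blast
    have "mono_on {0..J} k" using k(1) by (rule strict_mono_on_imp_mono_on)
    then have "v \<le> (W powr (r / 2)) powr (1 / r)"
      unfolding v using variation_leD[OF a] k(2) r by (intro powr_mono2) (auto intro!: sum_nonneg)
    also have "\<dots> = sqrt W"
      using r variation_le_nonneg[OF a] by (simp add: powr_powr powr_half_sqrt)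
    finally show ?thesis .
  qed
  have "variation r a Z \<le> sqrt W"
    unfolding variation_def using Z le by (intro Max.boundedI finite_variation_sums variation_sums_nonempty)
  then have "(variation r a Z)\<^sup>2 \<le> (sqrt W)\<^sup>2"
    using variation_nonneg[OF Z] by (intro power_mono) auto
  then show ?thesis using variation_le_nonneg[OF a] by simp
qed

section \<open>Reversible random walks\<close>

text \<open>Symmetry makes counting measure stationary and the transition operator
  self-adjoint.\<close>

locale symmetric_kernel =
  fixes X :: "'a set" and p :: "'a \<Rightarrow> 'a \<Rightarrow> real"
  assumes finite_X: "finite X"
    and p_nonneg: "x \<in> X \<Longrightarrow> y \<in> X \<Longrightarrow> 0 \<le> p x y"
    and p_sym: "x \<in> X \<Longrightarrow> y \<in> X \<Longrightarrow> p x y = p y x"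
    and p_sum: "x \<in> X \<Longrightarrow> (\<Sum>y\<in>X. p x y) = 1"
begin

definition markov :: "('a \<Rightarrow> 'b::real_vector) \<Rightarrow> 'a \<Rightarrow> 'b" where
  "markov f x = (\<Sum>y\<in>X. p x y *\<^sub>R f y)"

definition paths :: "nat \<Rightarrow> 'a list set" where
  "paths i = {h. set h \<subseteq> X \<and> length h = Suc i}"

definition weight :: "'a list \<Rightarrow> real" where
  "weight h = (\<Prod>j<length h - 1. p (h ! j) (h ! Suc j))"

text \<open>Integration over the paths of the chain started from the counting measure on \<open>X\<close>.\<close>

definition path_sum :: "nat \<Rightarrow> ('a list \<Rightarrow> 'b::real_vector) \<Rightarrow> 'b" where
  "path_sum i F = (\<Sum>h\<in>paths i. weight h *\<^sub>R F h)"

lemma finite_paths: "finite (paths i)"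
  unfolding paths_def using finite_X by (rule finite_lists_length_eq)

lemma paths_0: "paths 0 = (\<lambda>x. [x]) ` X"
  by (auto simp: paths_def length_Suc_conv)

lemma paths_Suc: "paths (Suc i) = (\<lambda>(h, y). h @ [y]) ` (paths i \<times> X)"
proof
  show "paths (Suc i) \<subseteq> (\<lambda>(h, y). h @ [y]) ` (paths i \<times> X)"
  proof
    fix g assume g: "g \<in> paths (Suc i)"
    then have "g \<noteq> []" by (auto simp: paths_def)
    then have "g = butlast g @ [last g]" by simp
    moreover have "butlast g \<in> paths i" "last g \<in> X"
      using g \<open>g \<noteq> []\<close> by (auto simp: paths_def dest: in_set_butlastD)
    ultimately show "g \<in> (\<lambda>(h, y). h @ [y]) ` (paths i \<times> X)"
      by (intro image_eqI[of _ _ "(butlast g, last g)"]) auto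
  qed
qed (auto simp: paths_def)

lemma last_in_X: "h \<in> paths i \<Longrightarrow> last h \<in> X"
  by (cases "h = []") (auto simp: paths_def)

lemma last_eq_nth: "h \<in> paths i \<Longrightarrow> last h = h ! i"
  by (cases "h = []") (auto simp: paths_def last_conv_nth)

lemma weight_nonneg: "h \<in> paths i \<Longrightarrow> 0 \<le> weight h"
  unfolding weight_def paths_def by (intro prod_nonneg p_nonneg) (auto intro!: nth_mem)

lemma weight_snoc:
  assumes "h \<in> paths i"
  shows "weight (h @ [y]) = weight h * p (last h) y"
proof -
  have h: "length h = Suc i" using assms by (simp add: paths_def)
  have "weight (h @ [y]) = (\<Prod>j<Suc i. p ((h @ [y]) ! j) ((h @ [y]) ! Suc j))"
    by (simp add: weight_def h)
  also have "\<dots> = (\<Prod>j<i. p ((h @ [y]) ! j) ((h @ [y]) ! Suc j)) * p (last h) y"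
    by (simp add: h nth_append last_eq_nth[OF assms])
  also have "(\<Prod>j<i. p ((h @ [y]) ! j) ((h @ [y]) ! Suc j)) = weight h"
    unfolding weight_def h by (intro prod.cong) (auto simp: nth_append h)
  finally show ?thesis .
qed

lemma path_sum_0: "path_sum 0 F = (\<Sum>x\<in>X. F [x])"
  unfolding path_sum_def paths_0 by (subst sum.reindex) (auto simp: inj_on_def weight_def)

text \<open>The tower property: the last step is integrated out given the earlier vertices. All
  inductions over path length rest on it.\<close>

lemma path_sum_Suc:
  "path_sum (Suc i) F = path_sum i (\<lambda>h. \<Sum>y\<in>X. p (last h) y *\<^sub>R F (h @ [y]))"
proof -
  have "path_sum (Suc i) F = (\<Sum>(h, y)\<in>paths i \<times> X. weight (h @ [y]) *\<^sub>R F (h @ [y]))"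
    unfolding path_sum_def paths_Suc
    by (subst sum.reindex) (auto simp: inj_on_def intro!: sum.cong)
  also have "\<dots> = (\<Sum>h\<in>paths i. \<Sum>y\<in>X. weight (h @ [y]) *\<^sub>R F (h @ [y]))"
    by (simp add: sum.cartesian_product)
  also have "\<dots> = path_sum i (\<lambda>h. \<Sum>y\<in>X. p (last h) y *\<^sub>R F (h @ [y]))"
    unfolding path_sum_def by (intro sum.cong refl) (simp add: weight_snoc scaleR_sum_right)
  finally show ?thesis .
qed

lemma path_sum_cong: "(\<And>h. h \<in> paths i \<Longrightarrow> F h = G h) \<Longrightarrow> path_sum i F = path_sum i G"
  unfolding path_sum_def by (intro sum.cong) auto

lemma path_sum_mono:
  fixes F G :: "'a list \<Rightarrow> real"
  shows "(\<And>h. h \<in> paths i \<Longrightarrow> F h \<le> G h) \<Longrightarrow> path_sum i F \<le> path_sum i G"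
  unfolding path_sum_def by (intro sum_mono) (auto intro!: mult_left_mono weight_nonneg)

lemma path_sum_add: "path_sum i (\<lambda>h. F h + G h) = path_sum i F + path_sum i G"
  by (simp add: path_sum_def scaleR_add_right sum.distrib)

lemma path_sum_diff: "path_sum i (\<lambda>h. F h - G h) = path_sum i F - path_sum i G"
  by (simp add: path_sum_def scaleR_diff_right sum_subtractf)

lemma path_sum_mult:
  fixes F :: "'a list \<Rightarrow> real"
  shows "path_sum i (\<lambda>h. c * F h) = c * path_sum i F"
  by (simp add: path_sum_def sum_distrib_left mult_ac)

lemma path_sum_sum: "path_sum i (\<lambda>h. \<Sum>j\<in>I. F j h) = (\<Sum>j\<in>I. path_sum i (F j))"
  unfolding path_sum_def by (simp add: scaleR_sum_right) (rule sum.swap)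

lemma sum_markov: "(\<Sum>x\<in>X. markov f x) = (\<Sum>x\<in>X. f x)"
proof -
  have "(\<Sum>x\<in>X. markov f x) = (\<Sum>y\<in>X. \<Sum>x\<in>X. p x y *\<^sub>R f y)"
    unfolding markov_def by (rule sum.swap)
  also have "\<dots> = (\<Sum>y\<in>X. (\<Sum>x\<in>X. p y x) *\<^sub>R f y)"
    by (simp add: scaleR_sum_left p_sym cong: sum.cong)
  finally show ?thesis by (simp add: p_sum cong: sum.cong)
qed

lemma path_sum_last: "path_sum i (\<lambda>h. f (last h)) = (\<Sum>x\<in>X. f x)"
proof (induction i arbitrary: f)
  case (Suc i)
  have "path_sum (Suc i) (\<lambda>h. f (last h)) = path_sum i (\<lambda>h. markov f (last h))"
    by (simp add: path_sum_Suc markov_def)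
  then show ?case by (simp add: Suc.IH sum_markov)
qed (simp add: path_sum_0)

lemma markov_selfadjoint:
  fixes g :: "'a \<Rightarrow> 'b::real_vector"
  shows "(\<Sum>x\<in>X. markov c x *\<^sub>R g x) = (\<Sum>x\<in>X. c x *\<^sub>R markov g x)"
proof -
  have "(\<Sum>x\<in>X. markov c x *\<^sub>R g x) = (\<Sum>x\<in>X. \<Sum>y\<in>X. (p x y * c y) *\<^sub>R g x)"
    by (simp add: markov_def scaleR_sum_left)
  also have "\<dots> = (\<Sum>y\<in>X. \<Sum>x\<in>X. (p x y * c y) *\<^sub>R g x)" by (rule sum.swap)
  also have "\<dots> = (\<Sum>y\<in>X. c y *\<^sub>R markov g y)"
    unfolding markov_def scaleR_sum_right by (intro sum.cong refl) (simp add: p_sym mult.commute)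
  finally show ?thesis .
qed

text \<open>Integrating out the last step replaces \<open>c\<close> by \<open>markov c\<close>, and
  self-adjointness moves the operator to \<open>g\<close>. Thus looking back \<open>j\<close> steps
  from the endpoint is again \<open>j\<close> steps of the chain.\<close>

lemma path_sum_last_nth:
  fixes g :: "'a \<Rightarrow> 'b::real_vector"
  shows "path_sum (i + j) (\<lambda>h. c (last h) *\<^sub>R g (h ! i)) = (\<Sum>x\<in>X. c x *\<^sub>R (markov ^^ j) g x)"
proof (induction j arbitrary: c)
  case 0
  have "path_sum i (\<lambda>h. c (last h) *\<^sub>R g (h ! i)) = path_sum i (\<lambda>h. c (last h) *\<^sub>R g (last h))"
    by (rule path_sum_cong) (simp add: last_eq_nth)
  then show ?case using path_sum_last[of i "\<lambda>x. c x *\<^sub>R g x"] by simp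
next
  case (Suc j)
  have "path_sum (i + Suc j) (\<lambda>h. c (last h) *\<^sub>R g (h ! i))
      = path_sum (i + j) (\<lambda>h. \<Sum>y\<in>X. p (last h) y *\<^sub>R c y *\<^sub>R g ((h @ [y]) ! i))"
    by (simp add: path_sum_Suc)
  also have "\<dots> = path_sum (i + j) (\<lambda>h. markov c (last h) *\<^sub>R g (h ! i))"
    by (rule path_sum_cong) (auto simp: markov_def scaleR_sum_left nth_append paths_def)
  also have "\<dots> = (\<Sum>x\<in>X. c x *\<^sub>R (markov ^^ Suc j) g x)"
    by (simp add: Suc.IH markov_selfadjoint)
  finally show ?case .
qed

text \<open>Along a path \<open>h\<close> of length \<open>K\<close> the values \<open>path_value f K h i\<close>, \<open>i \<le> K\<close>, form a martingale.\<close>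

definition path_value :: "('a \<Rightarrow> 'b::real_vector) \<Rightarrow> nat \<Rightarrow> 'a list \<Rightarrow> nat \<Rightarrow> 'b" where
  "path_value f K h i = (markov ^^ (K - i)) f (h ! i)"

lemma path_value_snoc: "h \<in> paths i \<Longrightarrow> j \<le> i \<Longrightarrow> path_value f K (h @ [y]) j = path_value f K h j"
  by (auto simp: path_value_def paths_def nth_append)

lemma path_value_snoc_new: "h \<in> paths i \<Longrightarrow> path_value f K (h @ [y]) (Suc i) = (markov ^^ (K - Suc i)) f y"
  by (auto simp: path_value_def paths_def nth_append)

lemma path_value_martingale:
  assumes "i < K" "h \<in> paths i"
  shows "(\<Sum>y\<in>X. p (last h) y *\<^sub>R (markov ^^ (K - Suc i)) f y) = path_value f K h i"
proof -
  have "K - i = Suc (K - Suc i)" using assms by simp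
  then have "path_value f K h i = markov ((markov ^^ (K - Suc i)) f) (last h)"
    using assms(2) by (simp add: path_value_def last_eq_nth)
  then show ?thesis by (simp add: markov_def)
qed

lemma path_sum_norm_sq:
  "path_sum K (\<lambda>h. (norm (path_value f K h K))\<^sup>2) = (\<Sum>x\<in>X. (norm (f x))\<^sup>2)"
proof -
  have "path_sum K (\<lambda>h. (norm (path_value f K h K))\<^sup>2) = path_sum K (\<lambda>h. (norm (f (last h)))\<^sup>2)"
    by (rule path_sum_cong) (simp add: path_value_def last_eq_nth)
  then show ?thesis using path_sum_last[of K "\<lambda>x. (norm (f x))\<^sup>2"] by simp
qed

section \<open>Energy and maximal inequalities for the path martingale\<close>

text \<open>The difference of the two squares is affine in \<open>z y\<close>, so it commutes with
  averaging.\<close>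

lemma sum_sq_dist_minus_sq:
  fixes z :: "'a \<Rightarrow> 'b::real_inner"
  assumes x: "x \<in> X" and m: "(\<Sum>y\<in>X. p x y *\<^sub>R z y) = m"
  shows "(\<Sum>y\<in>X. p x y * (s + (norm (z y - a))\<^sup>2 - (norm (z y))\<^sup>2)) = s + (norm (m - a))\<^sup>2 - (norm m)\<^sup>2"
proof -
  have *: "(norm (w - a))\<^sup>2 - (norm w)\<^sup>2 = (norm a)\<^sup>2 - 2 * (w \<bullet> a)" for w :: 'b
    by (simp add: power2_norm_eq_inner inner_diff_left inner_diff_right inner_commute)
  have **: "s + (norm (w - a))\<^sup>2 - (norm w)\<^sup>2 = s + (norm a)\<^sup>2 - 2 * (w \<bullet> a)" for w :: 'b
    using *[of w] by linarith
  have "(\<Sum>y\<in>X. p x y * (s + (norm (z y - a))\<^sup>2 - (norm (z y))\<^sup>2))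
      = (\<Sum>y\<in>X. (s + (norm a)\<^sup>2) * p x y - 2 * ((p x y *\<^sub>R z y) \<bullet> a))"
    by (intro sum.cong refl) (simp only: **, simp add: algebra_simps)
  also have "\<dots> = (s + (norm a)\<^sup>2) * (\<Sum>y\<in>X. p x y) - 2 * ((\<Sum>y\<in>X. p x y *\<^sub>R z y) \<bullet> a)"
    by (simp only: sum_subtractf sum_distrib_left inner_sum_left)
  also have "\<dots> = s + (norm (m - a))\<^sup>2 - (norm m)\<^sup>2"
    using x m by (simp add: p_sum **)
  finally show ?thesis .
qed

text \<open>The summed quantity is a martingale. Whether or not the anchor moves, its new value is
  the old energy plus the squared distance of the new value to the old anchor, minus the new squared
  norm: a jump merely transfers the distance term to the energy.\<close>

lemma path_sum_jump_energy_aux: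
  fixes f :: "'a \<Rightarrow> 'b::real_inner"
  assumes "i \<le> K"
  shows "path_sum i (\<lambda>h. let v = path_value f K h in
      jump_energy \<theta> v i + (norm (v i - anchor \<theta> v i))\<^sup>2 - (norm (v i))\<^sup>2) \<le> 0"
  using assms
proof (induction i)
  case 0
  then show ?case by (simp add: path_sum_0 Let_def sum_nonneg sum_negf)
next
  case (Suc i)
  define \<Phi> where "\<Phi> h i = jump_energy \<theta> (path_value f K h) i
    + (norm (path_value f K h i - anchor \<theta> (path_value f K h) i))\<^sup>2 - (norm (path_value f K h i))\<^sup>2" for h i
  have "path_sum (Suc i) (\<lambda>h. \<Phi> h (Suc i)) = path_sum i (\<lambda>h. \<Phi> h i)"
    unfolding path_sum_Suc
  proof (rule path_sum_cong)
    fix h assume h: "h \<in> paths i"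
    let ?v = "path_value f K h"
    define z where "z = (markov ^^ (K - Suc i)) f"
    have "\<Phi> (h @ [y]) (Suc i) = jump_energy \<theta> ?v i + (norm (z y - anchor \<theta> ?v i))\<^sup>2 - (norm (z y))\<^sup>2" for y
    proof -
      let ?w = "path_value f K (h @ [y])"
      have w: "?w j = ?v j" if "j \<le> i" for j using path_value_snoc[OF h that] .
      have "jump_energy \<theta> ?w i = jump_energy \<theta> ?v i" "anchor \<theta> ?w i = anchor \<theta> ?v i"
        using w by (auto intro: jump_energy_cong anchor_cong)
      moreover have "?w (Suc i) = z y" by (simp add: path_value_snoc_new[OF h] z_def)
      ultimately show ?thesis unfolding \<Phi>_def by (simp del: running_max.simps)
    qed
    then have "(\<Sum>y\<in>X. p (last h) y *\<^sub>R \<Phi> (h @ [y]) (Suc i))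
        = jump_energy \<theta> ?v i + (norm (?v i - anchor \<theta> ?v i))\<^sup>2 - (norm (?v i))\<^sup>2"
      using sum_sq_dist_minus_sq[OF last_in_X[OF h], of z "?v i"] path_value_martingale[of i K h f] Suc.prems h
      by (simp add: z_def)
    then show "(\<Sum>y\<in>X. p (last h) y *\<^sub>R \<Phi> (h @ [y]) (Suc i)) = \<Phi> h i" by (simp add: \<Phi>_def)
  qed
  then show ?case using Suc by (simp add: Let_def \<Phi>_def del: running_max.simps anchor.simps jump_energy.simps)
qed

lemma path_sum_jump_energy:
  fixes f :: "'a \<Rightarrow> 'b::real_inner"
  shows "path_sum K (\<lambda>h. jump_energy \<theta> (path_value f K h) K) \<le> (\<Sum>x\<in>X. (norm (f x))\<^sup>2)"
proof -
  have "path_sum K (\<lambda>h. jump_energy \<theta> (path_value f K h) K - (norm (path_value f K h K))\<^sup>2) \<le> 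
    path_sum K (\<lambda>h. let v = path_value f K h in
      jump_energy \<theta> v K + (norm (v K - anchor \<theta> v K))\<^sup>2 - (norm (v K))\<^sup>2)"
    by (rule path_sum_mono) (simp add: Let_def)
  also have "\<dots> \<le> 0" by (rule path_sum_jump_energy_aux) simp
  finally show ?thesis by (simp add: path_sum_diff path_sum_norm_sq)
qed

text \<open>Doob's maximal inequality: \<open>m\<^sup>2 - 2 m s\<close> is a supermartingale if \<open>m\<close> is the running maximum of the
  nonnegative submartingale \<open>s\<close>.\<close>

lemma path_sum_running_max_aux:
  fixes f :: "'a \<Rightarrow> 'b::real_normed_vector"
  assumes "i \<le> K"
  shows "path_sum i (\<lambda>h. let v = path_value f K h in
      (running_max v i)\<^sup>2 - 2 * running_max v i * norm (v i)) \<le> 0"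
  using assms
proof (induction i)
  case 0
  then show ?case by (simp add: path_sum_0 Let_def sum_nonneg power2_eq_square sum_negf)
next
  case (Suc i)
  define \<Phi> where "\<Phi> h i = (running_max (path_value f K h) i)\<^sup>2
    - 2 * running_max (path_value f K h) i * norm (path_value f K h i)" for h i
  have "path_sum (Suc i) (\<lambda>h. \<Phi> h (Suc i)) \<le> path_sum i (\<lambda>h. \<Phi> h i)"
    unfolding path_sum_Suc
  proof (rule path_sum_mono)
    fix h assume h: "h \<in> paths i"
    let ?v = "path_value f K h"
    define z where "z = (markov ^^ (K - Suc i)) f"
    define m where "m = running_max ?v i"
    have m0: "0 \<le> m" by (simp add: m_def running_max_nonneg)
    have x: "last h \<in> X" using h by (rule last_in_X)
    have "\<Phi> (h @ [y]) (Suc i) \<le> m\<^sup>2 - 2 * m * norm (z y)" for y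
    proof -
      let ?w = "path_value f K (h @ [y])"
      have w: "?w j = ?v j" if "j \<le> i" for j using path_value_snoc[OF h that] .
      have "running_max ?w i = m" unfolding m_def using w by (rule running_max_cong)
      moreover have "?w (Suc i) = z y" by (simp add: path_value_snoc_new[OF h] z_def)
      ultimately have "\<Phi> (h @ [y]) (Suc i) = (max m (norm (z y)))\<^sup>2 - 2 * max m (norm (z y)) * norm (z y)"
        by (simp add: \<Phi>_def)
      \<comment> \<open>If the new norm exceeds \<open>m\<close>, the left side is minus its square,
        and the inequality is \<open>(m - norm (z y))^2 \<ge> 0\<close>.\<close>
      also have "\<dots> \<le> m\<^sup>2 - 2 * m * norm (z y)"
        using zero_le_power2[of "m - norm (z y)"]
        by (auto simp: max_def power2_eq_square algebra_simps)
      finally show ?thesis .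
    qed
    then have "(\<Sum>y\<in>X. p (last h) y *\<^sub>R \<Phi> (h @ [y]) (Suc i))
        \<le> (\<Sum>y\<in>X. p (last h) y *\<^sub>R (m\<^sup>2 - 2 * m * norm (z y)))"
      using x by (intro sum_mono) (auto intro!: mult_left_mono p_nonneg)
    also have "\<dots> = (\<Sum>y\<in>X. m\<^sup>2 * p (last h) y - 2 * m * norm (p (last h) y *\<^sub>R z y))"
      using x p_nonneg[OF x] by (intro sum.cong) (auto simp: algebra_simps)
    also have "\<dots> = m\<^sup>2 * (\<Sum>y\<in>X. p (last h) y) - 2 * m * (\<Sum>y\<in>X. norm (p (last h) y *\<^sub>R z y))"
      by (simp only: sum_subtractf sum_distrib_left)
    also have "\<dots> \<le> m\<^sup>2 * 1 - 2 * m * norm (\<Sum>y\<in>X. p (last h) y *\<^sub>R z y)"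
      using x m0 by (intro diff_mono mult_left_mono norm_sum) (auto simp: p_sum)
    also have "\<dots> = \<Phi> h i"
      using path_value_martingale[of i K h f] Suc.prems h by (simp add: \<Phi>_def m_def z_def)
    finally show "(\<Sum>y\<in>X. p (last h) y *\<^sub>R \<Phi> (h @ [y]) (Suc i)) \<le> \<Phi> h i" .
  qed
  then show ?case using Suc by (simp add: Let_def \<Phi>_def del: running_max.simps)
qed

text \<open>Completing the square: \<open>m^2 \<le> 2 (m^2 - 2 m s) + 4 s^2\<close> is
  \<open>(m - 2 s)^2 \<ge> 0\<close>. The last term yields Doob's constant 4.\<close>

lemma path_sum_running_max:
  fixes f :: "'a \<Rightarrow> 'b::real_normed_vector"
  shows "path_sum K (\<lambda>h. (running_max (path_value f K h) K)\<^sup>2) \<le> 4 * (\<Sum>x\<in>X. (norm (f x))\<^sup>2)"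
proof -
  have "path_sum K (\<lambda>h. (running_max (path_value f K h) K)\<^sup>2)
    \<le> path_sum K (\<lambda>h. 2 * (let v = path_value f K h in
      (running_max v K)\<^sup>2 - 2 * running_max v K * norm (v K)) + 4 * (norm (path_value f K h K))\<^sup>2)"
  proof (rule path_sum_mono)
    fix h
    have "m\<^sup>2 \<le> 2 * (m\<^sup>2 - 2 * m * s) + 4 * s\<^sup>2" for m s :: real
      using zero_le_power2[of "m - 2 * s"] by (simp add: power2_eq_square algebra_simps)
    then show "(running_max (path_value f K h) K)\<^sup>2 \<le> 2 * (let v = path_value f K h in
      (running_max v K)\<^sup>2 - 2 * running_max v K * norm (v K)) + 4 * (norm (path_value f K h K))\<^sup>2"
      by (simp only: Let_def)
  qed
  also have "\<dots> \<le> 2 * 0 + 4 * (\<Sum>x\<in>X. (norm (f x))\<^sup>2)"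
    unfolding path_sum_add path_sum_mult path_sum_norm_sq
    by (intro add_mono mult_left_mono path_sum_running_max_aux) auto
  finally show ?thesis by simp
qed

end

text \<open>Doob's constant plus the geometric series of the scale weights, with ratio
  \<open>(1 / 2) powr (r - 2)\<close>; it blows up as \<open>r\<close> tends to 2.\<close>

definition lepingle_const :: "real \<Rightarrow> real" where
  "lepingle_const r = 4 + 64 * 4 powr (r - 2) / (1 - (1 / 2) powr (r - 2))"

context symmetric_kernel
begin

lemma path_sum_path_bound:
  fixes f :: "'a \<Rightarrow> 'b::real_inner"
  assumes r: "2 < r"
  shows "path_sum K (\<lambda>h. path_bound r P (path_value f K h) K) \<le> lepingle_const r * (\<Sum>x\<in>X. (norm (f x))\<^sup>2)"
proof -
  define N where "N = (\<Sum>x\<in>X. (norm (f x))\<^sup>2)"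
  define q where "q = (1 / 2 :: real) powr (r - 2)"
  have q: "0 \<le> q" "q < 1" using r powr_less_mono2_neg[of "-(r - 2)" 1 2] by (auto simp: q_def powr_divide powr_minus field_simps intro: ge_one_powr_ge_zero)
  have N: "0 \<le> N" by (simp add: N_def sum_nonneg)
  have c: "64 * (4 * (1 / 2) ^ p) powr (r - 2) = 64 * 4 powr (r - 2) * q ^ p" for p
  proof -
    have "((1 / 2 :: real) ^ p) powr (r - 2) = q ^ p"
      by (simp add: q_def powr_powr powr_realpow[symmetric] mult.commute)
    then show ?thesis by (simp add: powr_mult)
  qed
  have "path_sum K (\<lambda>h. path_bound r P (path_value f K h) K)
      = path_sum K (\<lambda>h. (running_max (path_value f K h) K)\<^sup>2)
        + (\<Sum>p=1..P. 64 * 4 powr (r - 2) * q ^ p * path_sum K (\<lambda>h. jump_energy ((1 / 2) ^ p) (path_value f K h) K))"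
    unfolding path_bound_def path_sum_add path_sum_sum c path_sum_mult ..
  also have "\<dots> \<le> 4 * N + (\<Sum>p=1..P. 64 * 4 powr (r - 2) * q ^ p * N)"
    unfolding N_def using q
    by (intro add_mono path_sum_running_max sum_mono mult_left_mono path_sum_jump_energy) auto
  also have "(\<Sum>p=1..P. 64 * 4 powr (r - 2) * q ^ p * N) = 64 * 4 powr (r - 2) * N * (\<Sum>p=1..P. q ^ p)"
    unfolding sum_distrib_left by (intro sum.cong refl) simp
  also have "\<dots> \<le> 64 * 4 powr (r - 2) * N * (1 / (1 - q))"
  proof (rule mult_left_mono)
    have "(\<Sum>p=1..P. q ^ p) \<le> (\<Sum>p<Suc P. q ^ p)"
      using q by (intro sum_mono2) auto
    also have "\<dots> = (1 - q ^ Suc P) / (1 - q)" using q by (subst sum_gp_strict) auto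
    also have "\<dots> \<le> 1 / (1 - q)" using q by (intro divide_right_mono) auto
    finally show "(\<Sum>p=1..P. q ^ p) \<le> 1 / (1 - q)" .
  qed (use N in simp)
  finally show ?thesis by (simp add: lepingle_const_def N_def q_def algebra_simps)
qed

section \<open>Rota's dilation and the variation of even powers\<close>

text \<open>The finest scale may depend on the path length \<open>K\<close>, because the bound in
  \<open>path_sum_path_bound\<close> is uniform in \<open>P\<close>.\<close>

lemma ex_dyadic_scale:
  fixes r :: real
  assumes "1 \<le> r"
  shows "\<exists>P\<ge>1. real K * (4 * (1 / 2) ^ P) powr r \<le> 1"
proof -
  obtain n where n: "(1 / 2 :: real) ^ n < 1 / (4 * (real K + 1))"
    using real_arch_pow_inv[of "1 / (4 * (real K + 1))" "1 / 2"] by auto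
  define e where "e = 4 * (1 / 2 :: real) ^ Suc n"
  have e: "0 \<le> e" "e \<le> 1 / (real K + 1)" using n by (auto simp: e_def field_simps)
  then have "e \<le> 1" by (smt (verit) divide_le_eq_1_pos of_nat_0_le_iff)
  then have "e powr r \<le> e powr 1" using e assms by (intro powr_mono') auto
  then have "real K * e powr r \<le> real K * (1 / (real K + 1))" using e by (intro mult_left_mono) auto
  then have "real K * e powr r \<le> 1" by (smt (verit) divide_le_eq_1_pos of_nat_0_le_iff times_divide_eq_right mult_cancel_left2)
  then show ?thesis unfolding e_def by (intro exI[of _ "Suc n"]) auto
qed

text \<open>Rota's dilation: \<open>markov ^^ (2 * k)\<close> is the conditional expectation, given the last vertex of the
  path, of the martingale value at time \<open>K - k\<close>.\<close>

lemma markov_power_eq_average: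
  fixes f :: "'a \<Rightarrow> 'b::real_vector"
  assumes x: "x \<in> X" and k: "k \<le> K"
  shows "(markov ^^ (2 * k)) f x
    = (\<Sum>h\<in>paths K. (weight h * (if last h = x then 1 else 0)) *\<^sub>R path_value f K h (K - k))"
proof -
  let ?c = "\<lambda>y. if y = x then 1 else (0::real)"
  have "(\<Sum>h\<in>paths K. (weight h * ?c (last h)) *\<^sub>R path_value f K h (K - k))
      = path_sum ((K - k) + k) (\<lambda>h. ?c (last h) *\<^sub>R (markov ^^ k) f (h ! (K - k)))"
    using k by (simp add: path_sum_def path_value_def)
  also have "\<dots> = (\<Sum>y\<in>X. ?c y *\<^sub>R (markov ^^ k) ((markov ^^ k) f) y)"
    by (rule path_sum_last_nth)
  also have "\<dots> = (\<Sum>y\<in>X. if y = x then (markov ^^ (2 * k)) f y else 0)"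
    by (intro sum.cong) (auto simp: mult_2 funpow_add)
  finally show ?thesis using x finite_X by simp
qed

text \<open>\<open>W x\<close> is the law of the path conditioned to end at \<open>x\<close>; each
  endpoint has mass one by stationarity. Averaging the bound for the time-reversed martingale gives
  \<open>Y x\<close>, and summing over \<open>x\<close> undoes the conditioning.\<close>

theorem markov_variation:
  fixes f :: "'a \<Rightarrow> complex"
  assumes r: "2 < r"
  obtains Y where "\<And>x. x \<in> X \<Longrightarrow> variation_le r (\<lambda>k. (markov ^^ (2 * k)) f x) {..K} (Y x)"
    and "(\<Sum>x\<in>X. Y x) \<le> lepingle_const r * (\<Sum>x\<in>X. (norm (f x))\<^sup>2)"
proof -
  obtain P where P: "1 \<le> P" "real K * (4 * (1 / 2) ^ P) powr r \<le> 1"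
    using ex_dyadic_scale[of r K] r by auto
  define B where "B h = path_bound r P (path_value f K h) K" for h
  define W where "W x h = weight h * (if last h = x then 1 else (0::real))" for x h
  define Y where "Y x = (\<Sum>h\<in>paths K. W x h * B h)" for x
  show thesis
  proof
    fix x assume x: "x \<in> X"
    have W1: "(\<Sum>h\<in>paths K. W x h) = 1"
      using path_sum_last[of K "\<lambda>y. if y = x then 1 else (0::real)"] x finite_X
      by (simp add: path_sum_def W_def)
    have "variation_le r (\<lambda>k. \<Sum>h\<in>paths K. W x h *\<^sub>R path_value f K h (K - k)) {..K} (Y x)"
      unfolding Y_def
    proof (rule variation_le_average[OF finite_paths _ W1])
      fix h assume h: "h \<in> paths K"
      show "0 \<le> W x h" using weight_nonneg[OF h] by (simp add: W_def)
      show "variation_le r (\<lambda>k. path_value f K h (K - k)) {..K} (B h)"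
        unfolding B_def
        by (rule variation_le_comp_antimono[OF path_variation[OF r P]]) (auto simp: monotone_on_def)
    qed (use r in simp)
    then show "variation_le r (\<lambda>k. (markov ^^ (2 * k)) f x) {..K} (Y x)"
      by (rule variation_le_cong) (simp add: markov_power_eq_average[OF x] W_def)
  next
    have "(\<Sum>x\<in>X. Y x) = (\<Sum>h\<in>paths K. \<Sum>x\<in>X. W x h * B h)"
      unfolding Y_def by (rule sum.swap)
    also have "\<dots> = path_sum K B"
      unfolding path_sum_def
    proof (intro sum.cong refl)
      fix h assume h: "h \<in> paths K"
      have "(\<Sum>x\<in>X. W x h * B h) = (\<Sum>x\<in>X. if x = last h then weight h * B h else 0)"
        by (intro sum.cong) (auto simp: W_def)
      then show "(\<Sum>x\<in>X. W x h * B h) = weight h *\<^sub>R B h" using last_in_X[OF h] finite_X by simp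
    qed
    finally show "(\<Sum>x\<in>X. Y x) \<le> lepingle_const r * (\<Sum>x\<in>X. (norm (f x))\<^sup>2)"
      using path_sum_path_bound[OF r, of K P f] unfolding B_def by simp
  qed
qed

end

section \<open>Walsh functions on the cube\<close>

declare One_nat_def [simp del]

lemma finite_cube [simp]: "finite (cube n)"
  unfolding cube_def by (intro finite_PiE) auto

lemma cube_ext: "x \<in> cube n \<Longrightarrow> y \<in> cube n \<Longrightarrow> (\<And>j. j \<in> {1..n} \<Longrightarrow> x j = y j) \<Longrightarrow> x = y"
  unfolding cube_def by (rule PiE_ext)

lemma cube_values: "x \<in> cube n \<Longrightarrow> j \<in> {1..n} \<Longrightarrow> x j = 0 \<or> x j = 1"
  by (auto simp: cube_def dest!: PiE_mem)

definition walsh :: "nat set \<Rightarrow> (nat \<Rightarrow> nat) \<Rightarrow> complex" where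
  "walsh M x = (\<Prod>j\<in>M. (-1) ^ x j)"

definition walsh_coeff :: "nat \<Rightarrow> ((nat \<Rightarrow> nat) \<Rightarrow> complex) \<Rightarrow> nat set \<Rightarrow> complex" where
  "walsh_coeff n f M = (\<Sum>x\<in>cube n. f x * walsh M x)"

text \<open>A Fourier multiplier whose symbol depends only on the size of the frequency set. The
  coefficients are unnormalised, hence the division by \<open>2 ^ n\<close>.\<close>

definition multiplier :: "nat \<Rightarrow> (nat \<Rightarrow> real) \<Rightarrow> ((nat \<Rightarrow> nat) \<Rightarrow> complex) \<Rightarrow> (nat \<Rightarrow> nat) \<Rightarrow> complex" where
  "multiplier n a f x = (\<Sum>M\<in>Pow {1..n}. a (card M) *\<^sub>R (walsh_coeff n f M * walsh M x)) / 2 ^ n"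

lemma cnj_walsh [simp]: "cnj (walsh M x) = walsh M x"
  by (simp add: walsh_def)

text \<open>The sum over all \<open>M\<close> factorises over coordinates, and a coordinate where
  \<open>x\<close> and \<open>y\<close> differ gives a factor 0.\<close>

lemma walsh_orthogonal_points:
  assumes x: "x \<in> cube n" and y: "y \<in> cube n"
  shows "(\<Sum>M\<in>Pow {1..n}. walsh M x * walsh M y) = (if x = y then 2 ^ n else 0)"
proof -
  have "(\<Sum>M\<in>Pow {1..n}. walsh M x * walsh M y) = (\<Prod>j\<in>{1..n}. (-1) ^ (x j) * (-1) ^ (y j) + 1)"
    by (subst prod_add) (auto simp: walsh_def prod.distrib)
  also have "\<dots> = (if x = y then 2 ^ n else 0)"
  proof (cases "x = y")
    case True
    then show ?thesis by (simp flip: power_add add: mult_2[symmetric])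
  next
    case False
    then obtain j where j: "j \<in> {1..n}" "x j \<noteq> y j" using cube_ext[OF x y] by blast
    then have "(-1) ^ (x j) * (-1) ^ (y j) + 1 = (0::complex)"
      using cube_values[OF x j(1)] cube_values[OF y j(1)] by auto
    then show ?thesis using j False by (auto intro!: prod_zero)
  qed
  finally show ?thesis .
qed

lemma walsh_orthogonal_sets:
  assumes M: "M \<subseteq> {1..n}" and N: "N \<subseteq> {1..n}"
  shows "(\<Sum>x\<in>cube n. walsh M x * walsh N x) = (if M = N then 2 ^ n else 0)"
proof -
  define g where "g j b = (if j \<in> M then (-1) ^ b else 1) * (if j \<in> N then (-1) ^ b else (1::complex))" for j b :: nat
  have w: "walsh M x = (\<Prod>j\<in>{1..n}. if j \<in> M then (-1) ^ x j else 1)" if "M \<subseteq> {1..n}" for M x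
    unfolding walsh_def using that by (subst prod.inter_restrict[symmetric]) (auto simp: Int_absorb1)
  have "(\<Sum>x\<in>cube n. walsh M x * walsh N x) = (\<Sum>x\<in>cube n. \<Prod>j\<in>{1..n}. g j (x j))"
    by (simp only: w[OF M] w[OF N] g_def prod.distrib)
  also have "\<dots> = (\<Prod>j\<in>{1..n}. \<Sum>b\<in>{0, 1}. g j b)"
    unfolding cube_def by (rule prod_sum_PiE[symmetric]) auto
  also have "\<dots> = (if M = N then 2 ^ n else 0)"
  proof (cases "M = N")
    case True
    then have "(\<Prod>j\<in>{1..n}. \<Sum>b\<in>{0, 1}. g j b) = (\<Prod>j\<in>{1..n}. 2)"
      by (intro prod.cong) (auto simp: g_def)
    then show ?thesis using True by simp
  next
    case False
    then obtain j where j: "j \<in> {1..n}" "(j \<in> M) \<noteq> (j \<in> N)" using M N by blast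
    then have "(\<Sum>b\<in>{0, 1}. g j b) = 0" by (auto simp: g_def)
    then show ?thesis using j False by (auto intro!: prod_zero)
  qed
  finally show ?thesis .
qed

lemma walsh_inversion:
  assumes x: "x \<in> cube n"
  shows "(\<Sum>M\<in>Pow {1..n}. walsh_coeff n f M * walsh M x) = 2 ^ n * f x"
proof -
  have "(\<Sum>M\<in>Pow {1..n}. walsh_coeff n f M * walsh M x)
      = (\<Sum>M\<in>Pow {1..n}. \<Sum>y\<in>cube n. f y * (walsh M y * walsh M x))"
    by (simp add: walsh_coeff_def sum_distrib_right mult.assoc)
  also have "\<dots> = (\<Sum>y\<in>cube n. \<Sum>M\<in>Pow {1..n}. f y * (walsh M y * walsh M x))"
    by (rule sum.swap)
  also have "\<dots> = (\<Sum>y\<in>cube n. if y = x then 2 ^ n * f y else 0)"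
    by (intro sum.cong) (auto simp: walsh_orthogonal_points[OF _ x] simp flip: sum_distrib_left)
  finally show ?thesis using x by simp
qed

lemma multiplier_one: "x \<in> cube n \<Longrightarrow> multiplier n (\<lambda>_. 1) f x = f x"
  by (simp add: multiplier_def walsh_inversion)

lemma walsh_coeff_multiplier:
  assumes N: "N \<subseteq> {1..n}"
  shows "walsh_coeff n (multiplier n a f) N = a (card N) *\<^sub>R walsh_coeff n f N"
proof -
  define c where "c M = a (card M) *\<^sub>R walsh_coeff n f M / 2 ^ n" for M
  have "walsh_coeff n (multiplier n a f) N = (\<Sum>x\<in>cube n. \<Sum>M\<in>Pow {1..n}. c M * (walsh M x * walsh N x))"
    unfolding walsh_coeff_def[of n "multiplier n a f"] multiplier_def sum_divide_distrib sum_distrib_right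
    by (intro sum.cong refl) (simp add: c_def)
  also have "\<dots> = (\<Sum>M\<in>Pow {1..n}. c M * (\<Sum>x\<in>cube n. walsh M x * walsh N x))"
    unfolding sum_distrib_left by (rule sum.swap)
  also have "\<dots> = (\<Sum>M\<in>Pow {1..n}. if M = N then c M * 2 ^ n else 0)"
    by (intro sum.cong refl) (use walsh_orthogonal_sets[OF _ N] in auto)
  finally show ?thesis using N by (simp add: c_def scaleR_conv_of_real)
qed

lemma multiplier_multiplier: "multiplier n a (multiplier n b f) x = multiplier n (\<lambda>m. a m * b m) f x"
  unfolding multiplier_def[of n a] multiplier_def[of n "\<lambda>m. a m * b m"]
  by (intro arg_cong2[where f = "(/)"] sum.cong) (auto simp: walsh_coeff_multiplier)

lemma multiplier_diff: "multiplier n (\<lambda>m. a m - b m) f x = multiplier n a f x - multiplier n b f x"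
  by (simp add: multiplier_def scaleR_diff_left sum_subtractf diff_divide_distrib)

lemma multiplier_cong: "(\<And>m. m \<le> n \<Longrightarrow> a m = b m) \<Longrightarrow> multiplier n a f x = multiplier n b f x"
proof -
  assume *: "\<And>m. m \<le> n \<Longrightarrow> a m = b m"
  have "card M \<le> n" if "M \<subseteq> {1..n}" for M using card_mono[OF _ that] by simp
  then show ?thesis unfolding multiplier_def
    by (intro arg_cong2[where f = "(/)"] sum.cong) (auto simp: *)
qed

lemma parseval: "(\<Sum>x\<in>cube n. (cmod (f x))\<^sup>2) = (\<Sum>M\<in>Pow {1..n}. (cmod (walsh_coeff n f M))\<^sup>2) / 2 ^ n"
proof -
  have "complex_of_real (2 ^ n * (\<Sum>x\<in>cube n. (cmod (f x))\<^sup>2)) = (\<Sum>x\<in>cube n. (2 ^ n * f x) * cnj (f x))"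
    unfolding of_real_mult of_real_sum sum_distrib_left complex_norm_square by (simp add: mult.assoc)
  also have "\<dots> = (\<Sum>x\<in>cube n. \<Sum>M\<in>Pow {1..n}. walsh_coeff n f M * cnj (f x * walsh M x))"
  proof (intro sum.cong refl)
    fix x assume "x \<in> cube n"
    then show "2 ^ n * f x * cnj (f x) = (\<Sum>M\<in>Pow {1..n}. walsh_coeff n f M * cnj (f x * walsh M x))"
      unfolding walsh_inversion[OF \<open>x \<in> cube n\<close>, symmetric] sum_distrib_right
      by (intro sum.cong refl) simp
  qed
  also have "\<dots> = (\<Sum>M\<in>Pow {1..n}. \<Sum>x\<in>cube n. walsh_coeff n f M * cnj (f x * walsh M x))"
    by (rule sum.swap)
  also have "\<dots> = (\<Sum>M\<in>Pow {1..n}. walsh_coeff n f M * cnj (walsh_coeff n f M))"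
    by (simp add: walsh_coeff_def sum_distrib_left)
  also have "\<dots> = complex_of_real (\<Sum>M\<in>Pow {1..n}. (cmod (walsh_coeff n f M))\<^sup>2)"
    unfolding of_real_sum complex_norm_square ..
  finally have "2 ^ n * (\<Sum>x\<in>cube n. (cmod (f x))\<^sup>2) = (\<Sum>M\<in>Pow {1..n}. (cmod (walsh_coeff n f M))\<^sup>2)"
    by (simp only: of_real_eq_iff)
  then show ?thesis by (simp add: field_simps)
qed

lemma multiplier_norm:
  "(\<Sum>x\<in>cube n. (cmod (multiplier n a f x))\<^sup>2)
    = (\<Sum>M\<in>Pow {1..n}. (a (card M))\<^sup>2 * (cmod (walsh_coeff n f M))\<^sup>2) / 2 ^ n"
  unfolding parseval[of "multiplier n a f"]
  by (intro arg_cong2[where f = "(/)"] sum.cong) (auto simp: walsh_coeff_multiplier power_mult_distrib)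

text \<open>By Parseval a weighted square function is a sum over frequencies, so a pointwise bound
  for the symbols, uniform in \<open>m\<close>, is enough.\<close>

lemma multiplier_square_function_le:
  assumes "finite I" and c: "\<And>i. i \<in> I \<Longrightarrow> 0 \<le> c i"
    and B: "\<And>m. m \<le> n \<Longrightarrow> (\<Sum>i\<in>I. c i * (a i m)\<^sup>2) \<le> B"
  shows "(\<Sum>x\<in>cube n. \<Sum>i\<in>I. c i * (cmod (multiplier n (a i) f x))\<^sup>2) \<le> B * (\<Sum>x\<in>cube n. (cmod (f x))\<^sup>2)"
proof -
  define w where "w M = (cmod (walsh_coeff n f M))\<^sup>2 / 2 ^ n" for M
  have "(\<Sum>x\<in>cube n. \<Sum>i\<in>I. c i * (cmod (multiplier n (a i) f x))\<^sup>2)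
      = (\<Sum>i\<in>I. c i * (\<Sum>x\<in>cube n. (cmod (multiplier n (a i) f x))\<^sup>2))"
    by (subst sum.swap) (simp add: sum_distrib_left)
  also have "\<dots> = (\<Sum>i\<in>I. \<Sum>M\<in>Pow {1..n}. c i * (a i (card M))\<^sup>2 * w M)"
    by (simp add: multiplier_norm sum_distrib_left sum_divide_distrib w_def mult.assoc)
  also have "\<dots> = (\<Sum>M\<in>Pow {1..n}. (\<Sum>i\<in>I. c i * (a i (card M))\<^sup>2) * w M)"
    by (subst sum.swap) (simp add: sum_distrib_right)
  also have "\<dots> \<le> (\<Sum>M\<in>Pow {1..n}. B * w M)"
  proof (intro sum_mono mult_right_mono B)
    fix M assume "M \<in> Pow {1..n}"
    then show "card M \<le> n" using card_mono[of "{1..n}" M] by simp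
  qed (simp add: w_def)
  also have "\<dots> = B * (\<Sum>x\<in>cube n. (cmod (f x))\<^sup>2)"
    by (simp add: parseval sum_distrib_left sum_divide_distrib w_def)
  finally show ?thesis .
qed

section \<open>Bit flips and spherical means as multipliers\<close>

definition flip_bits :: "nat \<Rightarrow> nat set \<Rightarrow> (nat \<Rightarrow> nat) \<Rightarrow> nat \<Rightarrow> nat" where
  "flip_bits n A x = (\<lambda>j\<in>{1..n}. if j \<in> A then 1 - x j else x j)"

lemma flip_in_cube: "x \<in> cube n \<Longrightarrow> flip_bits n A x \<in> cube n"
  unfolding cube_def flip_bits_def by (rule PiE_I) (auto dest!: PiE_mem)

lemma flip_differs:
  assumes "x \<in> cube n" "A \<subseteq> {1..n}"
  shows "{j \<in> {1..n}. x j \<noteq> flip_bits n A x j} = A"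
proof -
  have "x j \<noteq> 1 - x j" if "j \<in> {1..n}" for j using cube_values[OF assms(1) that] by auto
  then show ?thesis using assms(2) by (auto simp: flip_bits_def)
qed

lemma flip_difference_set:
  assumes "x \<in> cube n" "y \<in> cube n"
  shows "flip_bits n {j \<in> {1..n}. x j \<noteq> y j} x = y"
proof (rule cube_ext[OF flip_in_cube[OF assms(1)] assms(2)])
  fix j assume j: "j \<in> {1..n}"
  show "flip_bits n {j \<in> {1..n}. x j \<noteq> y j} x j = y j"
    using cube_values[OF assms(1) j] cube_values[OF assms(2) j] j by (auto simp: flip_bits_def)
qed

lemma walsh_flip:
  assumes x: "x \<in> cube n" and M: "M \<subseteq> {1..n}"
  shows "walsh M (flip_bits n A x) = walsh M x * (-1) ^ card (A \<inter> M)"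
proof -
  have "finite M" using M finite_subset by blast
  have "walsh M (flip_bits n A x) = (\<Prod>j\<in>M. (-1) ^ x j * (if j \<in> A then -1 else 1))"
    unfolding walsh_def
  proof (intro prod.cong refl)
    fix j assume "j \<in> M"
    then show "(-1) ^ flip_bits n A x j = (-1 :: complex) ^ x j * (if j \<in> A then -1 else 1)"
      using M cube_values[OF x, of j] by (auto simp: flip_bits_def)
  qed
  also have "\<dots> = walsh M x * (-1) ^ card (A \<inter> M)"
    using \<open>finite M\<close> by (simp add: walsh_def prod.distrib prod.If_cases Int_commute)
  finally show ?thesis .
qed

lemma sum_sphere_eq_sum_flip:
  assumes x: "x \<in> cube n"
  shows "(\<Sum>y | y \<in> cube n \<and> hamming_dist n x y = k. g y) = (\<Sum>A | A \<subseteq> {1..n} \<and> card A = k. g (flip_bits n A x))"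
proof (rule sum.reindex_bij_witness[where i = "\<lambda>A. flip_bits n A x" and j = "\<lambda>y. {j \<in> {1..n}. x j \<noteq> y j}"])
  fix y assume y: "y \<in> {y. y \<in> cube n \<and> hamming_dist n x y = k}"
  show eq: "flip_bits n {j \<in> {1..n}. x j \<noteq> y j} x = y" using y by (intro flip_difference_set[OF x]) simp
  show "{j \<in> {1..n}. x j \<noteq> y j} \<in> {A. A \<subseteq> {1..n} \<and> card A = k}"
    using y by (auto simp: hamming_dist_def)
  show "g (flip_bits n {j \<in> {1..n}. x j \<noteq> y j} x) = g y" by (simp only: eq)
next
  fix A assume A: "A \<in> {A. A \<subseteq> {1..n} \<and> card A = k}"
  then show eq: "{j \<in> {1..n}. x j \<noteq> flip_bits n A x j} = A" by (intro flip_differs[OF x]) simp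
  show "flip_bits n A x \<in> {y. y \<in> cube n \<and> hamming_dist n x y = k}"
    unfolding mem_Collect_eq hamming_dist_def eq using A flip_in_cube[OF x] by simp
qed

lemma walsh_sphere_sum:
  assumes x: "x \<in> cube n" and M: "M \<subseteq> {1..n}"
  shows "(\<Sum>y | y \<in> cube n \<and> hamming_dist n x y = k. walsh M y) = krawtchouk n k (card M) *\<^sub>R walsh M x"
proof -
  have "(\<Sum>y | y \<in> cube n \<and> hamming_dist n x y = k. walsh M y)
      = walsh M x * complex_of_real (\<Sum>A | A \<subseteq> {1..n} \<and> card A = k. (-1) ^ card (A \<inter> M))"
    unfolding sum_sphere_eq_sum_flip[OF x]
    by (simp add: walsh_flip[OF x M] sum_distrib_left)
  also have "\<dots> = krawtchouk n k (card M) *\<^sub>R walsh M x"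
    using sum_signs_eq_krawtchouk[of "{1..n}" n M k] M by (simp add: scaleR_conv_of_real mult.commute)
  finally show ?thesis .
qed

text \<open>Expand \<open>f\<close> by Walsh inversion; by \<open>walsh_sphere_sum\<close> every
  Walsh function is an eigenfunction of summation over spheres.\<close>

lemma spherical_mean_eq_multiplier:
  assumes x: "x \<in> cube n"
  shows "spherical_mean n k f x = multiplier n (kraw_eig n k) f x"
proof -
  let ?S = "{y. y \<in> cube n \<and> hamming_dist n x y = k}"
  have "(\<Sum>y\<in>?S. f y) = (\<Sum>y\<in>?S. (\<Sum>M\<in>Pow {1..n}. walsh_coeff n f M * walsh M y) / 2 ^ n)"
    by (intro sum.cong) (auto simp: walsh_inversion)
  also have "\<dots> = (\<Sum>M\<in>Pow {1..n}. \<Sum>y\<in>?S. walsh_coeff n f M * walsh M y) / 2 ^ n"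
    by (subst sum.swap) (simp add: sum_divide_distrib)
  also have "\<dots> = (\<Sum>M\<in>Pow {1..n}. krawtchouk n k (card M) *\<^sub>R (walsh_coeff n f M * walsh M x)) / 2 ^ n"
    by (intro arg_cong2[where f = "(/)"] sum.cong refl) (auto simp: walsh_sphere_sum[OF x] simp flip: sum_distrib_left)
  finally show ?thesis
    by (simp add: spherical_mean_def multiplier_def kraw_eig_def sum_divide_distrib sum_distrib_left
        scaleR_conv_of_real field_simps)
qed

lemma kraw_eig_1: "1 \<le> n \<Longrightarrow> m \<le> n \<Longrightarrow> kraw_eig n 1 m = 1 - 2 * real m / real n"
  using kraw_eig_diff[of m n 0] kraw_eig_zero_freq[of 1 n] by (cases "m = 0") (auto simp: One_nat_def)

section \<open>The simple random walk on the cube\<close>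

definition flip_kernel :: "nat \<Rightarrow> (nat \<Rightarrow> nat) \<Rightarrow> (nat \<Rightarrow> nat) \<Rightarrow> real" where
  "flip_kernel n x y = (if hamming_dist n x y = 1 then 1 / real n else 0)"

lemma flip_kernel_sum:
  assumes "x \<in> cube n"
  shows "(\<Sum>y\<in>cube n. flip_kernel n x y *\<^sub>R f y) = spherical_mean n 1 f x"
proof -
  have "(\<Sum>y\<in>cube n. flip_kernel n x y *\<^sub>R f y) = (\<Sum>y | y \<in> cube n \<and> hamming_dist n x y = 1. (1 / real n) *\<^sub>R f y)"
    by (subst sum.inter_filter) (auto simp: flip_kernel_def intro!: sum.cong)
  then show ?thesis by (simp add: spherical_mean_def scaleR_conv_of_real sum_distrib_left One_nat_def)
qed

lemma symmetric_kernel_flip: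
  assumes n: "1 \<le> n"
  shows "symmetric_kernel (cube n) (flip_kernel n)"
proof
  fix x y assume "x \<in> cube n" "y \<in> cube n"
  have "hamming_dist n x y = hamming_dist n y x"
    unfolding hamming_dist_def by (rule arg_cong[where f = card]) auto
  then show "flip_kernel n x y = flip_kernel n y x" by (simp add: flip_kernel_def)
next
  fix x assume x: "x \<in> cube n"
  have "card {A. A \<subseteq> {1..n} \<and> card A = 1} = n" using n_subsets[of "{1..n}" 1] by (simp add: One_nat_def)
  then have "card {y. y \<in> cube n \<and> hamming_dist n x y = 1} = n"
    using sum_sphere_eq_sum_flip[OF x, where k = 1 and g = "\<lambda>_. 1::nat"] by simp
  moreover have "(\<Sum>y\<in>cube n. flip_kernel n x y) = (\<Sum>y | y \<in> cube n \<and> hamming_dist n x y = 1. 1 / real n)"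
    by (subst sum.inter_filter) (auto simp: flip_kernel_def intro!: sum.cong)
  ultimately show "(\<Sum>y\<in>cube n. flip_kernel n x y) = 1" using n by simp
qed (auto simp: flip_kernel_def)

lemma markov_power_eq_multiplier:
  assumes n: "1 \<le> n" and x: "x \<in> cube n"
  shows "(symmetric_kernel.markov (cube n) (flip_kernel n) ^^ k) f x
    = multiplier n (\<lambda>m. (1 - 2 * real m / real n) ^ k) f x"
proof -
  interpret symmetric_kernel "cube n" "flip_kernel n" by (rule symmetric_kernel_flip[OF n])
  have M: "markov g x = multiplier n (\<lambda>m. 1 - 2 * real m / real n) g x" if "x \<in> cube n" for g and x
  proof -
    have "markov g x = multiplier n (kraw_eig n 1) g x"
      using flip_kernel_sum[OF that] spherical_mean_eq_multiplier[OF that] by (simp add: markov_def)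
    then show ?thesis using kraw_eig_1[OF n] multiplier_cong[of n "kraw_eig n 1"] by simp
  qed
  show ?thesis using x
  proof (induction k arbitrary: x)
    case 0
    then show ?case by (simp add: multiplier_one)
  next
    case (Suc k)
    let ?g = "multiplier n (\<lambda>m. (1 - 2 * real m / real n) ^ k) f"
    have "(markov ^^ Suc k) f x = markov ((markov ^^ k) f) x" by simp
    also have "\<dots> = markov ?g x"
      unfolding markov_def[of "(markov ^^ k) f"] markov_def[of ?g]
      by (intro sum.cong refl) (simp add: Suc.IH)
    also have "\<dots> = multiplier n (\<lambda>m. (1 - 2 * real m / real n) * (1 - 2 * real m / real n) ^ k) f x"
      by (simp add: M[OF Suc.prems] multiplier_multiplier)
    finally show ?case by simp
  qed
qed

section \<open>Spherical means\<close>

text \<open>The counterpart in physical space of the summand in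
  \<open>eig_err_square_function\<close>.\<close>

definition increment_energy :: "(nat \<Rightarrow> complex) \<Rightarrow> nat \<Rightarrow> real" where
  "increment_energy h k = real (Suc k) * (cmod (h (Suc k) - h k))\<^sup>2 + (cmod (h k))\<^sup>2 / real (Suc k)"

lemma increment_energy_nonneg: "0 \<le> increment_energy h k"
  by (simp add: increment_energy_def)

text \<open>The cross term satisfies \<open>2 d u \<le> t d^2 + u^2 / t\<close> with
  \<open>t = k + 1\<close>, matching the two weights of the energy.\<close>

lemma norm_sq_step_le: "\<bar>(cmod (h (Suc k)))\<^sup>2 - (cmod (h k))\<^sup>2\<bar> \<le> 2 * increment_energy h k"
proof -
  define d where "d = cmod (h (Suc k) - h k)"
  define u where "u = cmod (h k)"
  define v where "v = cmod (h (Suc k))"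
  have uv: "0 \<le> u" "0 \<le> v" "\<bar>v - u\<bar> \<le> d"
    using norm_triangle_ineq3[of "h (Suc k)" "h k"] by (auto simp: u_def v_def d_def)
  have "\<bar>v\<^sup>2 - u\<^sup>2\<bar> = \<bar>v - u\<bar> * (v + u)"
    using uv by (simp add: power2_eq_square square_diff_square_factored abs_mult)
  also have "\<dots> \<le> d * (2 * u + d)"
    using uv by (intro mult_mono) auto
  also have "\<dots> = 2 * (d * u) + d\<^sup>2" by (simp add: power2_eq_square algebra_simps)
  also have "\<dots> \<le> 2 * (real (Suc k) * d\<^sup>2 + u\<^sup>2 / real (Suc k))"
  proof -
    define t where "t = real (Suc k)"
    have t: "1 \<le> t" by (simp add: t_def)
    have "0 \<le> (t * d - u)\<^sup>2 / t" using t by simp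
    then have "2 * (d * u) \<le> t * d\<^sup>2 + u\<^sup>2 / t"
      using t by (simp add: power2_eq_square field_simps)
    moreover have "1 * d\<^sup>2 \<le> t * d\<^sup>2" using t by (intro mult_right_mono) auto
    moreover have "0 \<le> u\<^sup>2 / t" using t by simp
    ultimately show ?thesis unfolding t_def[symmetric] by simp
  qed
  finally show ?thesis by (simp add: increment_energy_def d_def u_def v_def)
qed

lemma norm_sq_diff_le:
  assumes "i \<le> j"
  shows "\<bar>(cmod (h j))\<^sup>2 - (cmod (h i))\<^sup>2\<bar> \<le> 2 * (\<Sum>k\<in>{i..<j}. increment_energy h k)"
  using assms
proof (induction j rule: dec_induct)
  case (step j)
  then show ?case using norm_sq_step_le[of h j] by simp
qed simp

text \<open>The \<open>\<ell>\<^sup>2\<close> form of the Sobolev bound for \<open>\<integral> (t \<bar>h'\<bar>\<^sup>2 + \<bar>h\<bar>\<^sup>2 / t) dt\<close>: on intervals shorter than dyadic use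
  Cauchy--Schwarz, on longer ones compare with the point where \<open>\<bar>h\<bar>\<close> is minimal.\<close>

lemma increment_sq_le_energy:
  assumes ab: "a \<le> b"
  shows "(cmod (h b - h a))\<^sup>2 \<le> 16 * (\<Sum>k\<in>{a..<b}. increment_energy h k)"
proof (cases "a = b")
  case False
  then have ab: "a < b" using ab by simp
  define S where "S = (\<Sum>k\<in>{a..<b}. increment_energy h k)"
  have S0: "0 \<le> S" unfolding S_def by (intro sum_nonneg increment_energy_nonneg)
  have sub: "(\<Sum>k\<in>{i..<j}. increment_energy h k) \<le> S" if "a \<le> i" "j \<le> b" for i j
    unfolding S_def using that by (intro sum_mono2) (auto simp: increment_energy_nonneg)
  show ?thesis
  proof (cases "b \<le> 2 * a + 1")
    case True
    have "h b - h a = (\<Sum>k\<in>{a..<b}. h (Suc k) - h k)" using ab by (simp add: sum_Suc_diff')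
    then have "cmod (h b - h a) \<le> (\<Sum>k\<in>{a..<b}. cmod (h (Suc k) - h k))" by (simp add: norm_sum)
    then have "(cmod (h b - h a))\<^sup>2 \<le> (\<Sum>k\<in>{a..<b}. cmod (h (Suc k) - h k))\<^sup>2" by (intro power_mono) auto
    also have "\<dots> \<le> (\<Sum>k\<in>{a..<b}. (cmod (h (Suc k) - h k))\<^sup>2) * real (card {a..<b})"
      by (rule sum_squared_le_sum_of_squares)
    also have "\<dots> = (\<Sum>k\<in>{a..<b}. real (b - a) * (cmod (h (Suc k) - h k))\<^sup>2)"
      by (simp add: sum_distrib_left mult.commute)
    also have "\<dots> \<le> S"
      unfolding S_def
    proof (rule sum_mono)
      fix k assume "k \<in> {a..<b}"
      \<comment> \<open>In this case \<open>b - a \<le> a + 1 \<le> Suc k\<close>.\<close>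
      then have "real (b - a) * (cmod (h (Suc k) - h k))\<^sup>2 \<le> real (Suc k) * (cmod (h (Suc k) - h k))\<^sup>2"
        using True by (intro mult_right_mono) auto
      also have "\<dots> \<le> increment_energy h k" by (simp add: increment_energy_def)
      finally show "real (b - a) * (cmod (h (Suc k) - h k))\<^sup>2 \<le> increment_energy h k" .
    qed
    finally show ?thesis using S0 by (simp add: S_def)
  next
    case False
    obtain i where i: "i \<in> {a..<b}" and min: "\<And>k. k \<in> {a..<b} \<Longrightarrow> cmod (h i) \<le> cmod (h k)"
      using ex_min_if_finite[of "(\<lambda>k. cmod (h k)) ` {a..<b}"] ab by (force simp: not_less)
    \<comment> \<open>The interval now fills at least half of \<open>{0..<b}\<close>, so the weights
      \<open>1 / Suc k \<ge> 1 / b\<close> sum to at least \<open>1 / 2\<close> over it.\<close>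
    have "real b \<le> 2 * real (b - a)" using False ab by linarith
    then have "1 / 2 \<le> real (b - a) / real b" using ab by (simp add: le_divide_eq)
    then have "(cmod (h i))\<^sup>2 * (1 / 2) \<le> (cmod (h i))\<^sup>2 * (real (b - a) / real b)"
      by (rule mult_left_mono) simp
    also have "\<dots> = (\<Sum>k\<in>{a..<b}. (cmod (h i))\<^sup>2 / real b)" by (simp del: of_nat_diff)
    also have "\<dots> \<le> S"
      unfolding S_def
    proof (rule sum_mono)
      fix k assume k: "k \<in> {a..<b}"
      have "(cmod (h i))\<^sup>2 / real b \<le> (cmod (h k))\<^sup>2 / real (Suc k)"
        using k min[OF k] by (intro frac_le power_mono) auto
      also have "\<dots> \<le> increment_energy h k" by (simp add: increment_energy_def)
      finally show "(cmod (h i))\<^sup>2 / real b \<le> increment_energy h k" .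
    qed
    finally have i2: "(cmod (h i))\<^sup>2 \<le> 2 * S" by simp
    \<comment> \<open>From the minimum \<open>i\<close> to either endpoint the square grows by at
      most \<open>2 * S\<close>, starting from at most \<open>2 * S\<close>.\<close>
    have "(cmod (h a))\<^sup>2 \<le> 4 * S" "(cmod (h b))\<^sup>2 \<le> 4 * S"
      using norm_sq_diff_le[of a i h] norm_sq_diff_le[of i b h] sub[of a i] sub[of i b] i i2 by auto
    moreover have "(cmod (h b - h a))\<^sup>2 \<le> 2 * (cmod (h b))\<^sup>2 + 2 * (cmod (h a))\<^sup>2"
    proof -
      have "(cmod (h b - h a))\<^sup>2 \<le> (cmod (h b) + cmod (h a))\<^sup>2"
        by (intro power_mono norm_triangle_ineq4) auto
      also have "\<dots> \<le> 2 * (cmod (h b))\<^sup>2 + 2 * (cmod (h a))\<^sup>2"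
        using zero_le_power2[of "cmod (h b) - cmod (h a)"] by (simp add: power2_eq_square algebra_simps)
      finally show ?thesis .
    qed
    ultimately show ?thesis unfolding S_def by simp
  qed
qed simp

text \<open>Energies of adjacent intervals add up, so their partial sums form a control
  function.\<close>

lemma variation_le_energy:
  assumes r: "2 \<le> r"
  shows "variation_le r h {..N} (16 * (\<Sum>k<N. increment_energy h k))"
proof (rule variation_le_control[where w = "\<lambda>i. 16 * (\<Sum>k<i. increment_energy h k)"])
  have split: "(\<Sum>k<b. increment_energy h k) - (\<Sum>k<a. increment_energy h k) = (\<Sum>k\<in>{a..<b}. increment_energy h k)"
    if "a \<le> b" for a b :: nat
    using sum.atLeastLessThan_concat[of 0 a b "increment_energy h"] that by (simp add: lessThan_atLeast0)
  fix a b assume "a \<in> {..N}" "b \<in> {..N}" "a \<le> b"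
  then show "(cmod (h b - h a))\<^sup>2 \<le> 16 * (\<Sum>k<b. increment_energy h k) - 16 * (\<Sum>k<a. increment_energy h k)"
    using increment_sq_le_energy[of a b h] split[of a b] by simp
  have "(\<Sum>k<b. increment_energy h k) \<le> (\<Sum>k<N. increment_energy h k)"
    using \<open>b \<in> {..N}\<close> by (intro sum_mono2) (auto simp: increment_energy_nonneg)
  moreover have "0 \<le> (\<Sum>k<a. increment_energy h k)" by (intro sum_nonneg increment_energy_nonneg)
  ultimately show "16 * (\<Sum>k<b. increment_energy h k) - 16 * (\<Sum>k<a. increment_energy h k)
    \<le> 16 * (\<Sum>k<N. increment_energy h k)" by simp
qed (use r in auto)

text \<open>For \<open>k\<close> of the same parity as \<open>q\<close> the identity \<open>\<kappa>\<^sub>k(n - m) = (-1)\<^sup>k \<kappa>\<^sub>k(m)\<close> reduces high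
  frequencies to low ones; \<open>folded_eig\<close> extends this formula to all \<open>k\<close>.\<close>

definition fold_sign :: "nat \<Rightarrow> nat \<Rightarrow> nat \<Rightarrow> real" where
  "fold_sign n q m = (if 2 * m \<le> n then 1 else (-1) ^ q)"

definition fold_freq :: "nat \<Rightarrow> nat \<Rightarrow> nat" where
  "fold_freq n m = (if 2 * m \<le> n then m else n - m)"

definition folded_eig :: "nat \<Rightarrow> nat \<Rightarrow> nat \<Rightarrow> nat \<Rightarrow> real" where
  "folded_eig n q k m = fold_sign n q m * kraw_eig n k (fold_freq n m)"

lemma fold_freq_le: "2 * fold_freq n m \<le> n"
  by (auto simp: fold_freq_def)

lemma fold_sign_sq: "(fold_sign n q m)\<^sup>2 = 1"
  by (simp add: fold_sign_def flip: power_mult)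

lemma folded_eig_eq:
  assumes "k mod 2 = q mod 2" "m \<le> n"
  shows "folded_eig n q k m = kraw_eig n k m"
proof -
  have "(-1 :: real) ^ q = (-1) ^ k"
    using assms(1) by (metis even_iff_mod_2_eq_zero neg_one_even_power neg_one_odd_power)
  then show ?thesis
    using kraw_eig_reflect[of m n k] assms(2)
    by (auto simp: folded_eig_def fold_sign_def fold_freq_def simp flip: power_add)
qed

lemma folded_eig_sq_le_1: "(folded_eig n q k m)\<^sup>2 \<le> 1"
proof -
  have "fold_freq n m \<le> n" using fold_freq_le[of n m] by simp
  then show ?thesis
    using abs_kraw_eig_le_1[of "fold_freq n m" n k]
    by (simp add: folded_eig_def power_mult_distrib fold_sign_sq abs_square_le_1)
qed

text \<open>Folding only changes the sign of \<open>1 - 2 m / n\<close>, which even powers do not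
  see.\<close>

lemma walk_eig_fold:
  assumes "1 \<le> n" "m \<le> n"
  shows "(1 - 2 * real (fold_freq n m) / real n) ^ (2 * k) = (1 - 2 * real m / real n) ^ (2 * k)"
proof (cases "2 * m \<le> n")
  case False
  have "1 - 2 * real (n - m) / real n = - (1 - 2 * real m / real n)"
    using assms by (simp add: field_simps of_nat_diff)
  then have "(1 - 2 * real (n - m) / real n)\<^sup>2 = (1 - 2 * real m / real n)\<^sup>2"
    by (simp only: power2_minus)
  then show ?thesis using False by (simp add: fold_freq_def power_mult)
qed (simp add: fold_freq_def)

text \<open>In the last term the sign is independent of \<open>k\<close>, so it can be applied to
  \<open>f\<close> beforehand, leaving pure powers of the walk.\<close>

lemma folded_eig_decompose:
  assumes "1 \<le> n" "m \<le> n"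
  shows "folded_eig n q k m = fold_sign n q m * eig_err n k (fold_freq n m)
    + (1 - 2 * real m / real n) ^ (2 * k) * fold_sign n q m"
  unfolding folded_eig_def eig_err_def walk_eig_fold[OF assms] by (simp add: algebra_simps)

text \<open>Each of the two halves of the energy is transferred separately with the bound 79488,
  whence the doubled constant.\<close>

lemma eig_err_energy:
  assumes n: "1 \<le> n"
  shows "(\<Sum>x\<in>cube n. \<Sum>k<n div 2.
      increment_energy (\<lambda>k. multiplier n (\<lambda>m. fold_sign n q m * eig_err n k (fold_freq n m)) f x) k)
    \<le> 158976 * (\<Sum>x\<in>cube n. (cmod (f x))\<^sup>2)"
proof -
  define E where "E k m = fold_sign n q m * eig_err n k (fold_freq n m)" for k m
  define N where "N = n div 2"
  have E2: "(\<Sum>k<N. real (Suc k) * (E (Suc k) m - E k m)\<^sup>2 + (E k m)\<^sup>2 / real (Suc k)) \<le> 79488" for m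
  proof -
    have "(E (Suc k) m - E k m)\<^sup>2 = (eig_err n (Suc k) (fold_freq n m) - eig_err n k (fold_freq n m))\<^sup>2" for k
      unfolding E_def right_diff_distrib[symmetric] power_mult_distrib fold_sign_sq by simp
    moreover have "(E k m)\<^sup>2 = (eig_err n k (fold_freq n m))\<^sup>2" for k
      unfolding E_def power_mult_distrib fold_sign_sq by simp
    ultimately show ?thesis using eig_err_square_function[OF n fold_freq_le] by (simp add: N_def)
  qed
  have A: "(\<Sum>x\<in>cube n. \<Sum>k<N. real (Suc k) * (cmod (multiplier n (\<lambda>m. E (Suc k) m - E k m) f x))\<^sup>2)
      \<le> 79488 * (\<Sum>x\<in>cube n. (cmod (f x))\<^sup>2)"
  proof (rule multiplier_square_function_le)
    fix m
    have "(\<Sum>k<N. real (Suc k) * (E (Suc k) m - E k m)\<^sup>2)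
        \<le> (\<Sum>k<N. real (Suc k) * (E (Suc k) m - E k m)\<^sup>2 + (E k m)\<^sup>2 / real (Suc k))"
      by (intro sum_mono) simp
    then show "(\<Sum>k<N. real (Suc k) * (E (Suc k) m - E k m)\<^sup>2) \<le> 79488" using E2[of m] by simp
  qed auto
  have B: "(\<Sum>x\<in>cube n. \<Sum>k<N. (1 / real (Suc k)) * (cmod (multiplier n (E k) f x))\<^sup>2)
      \<le> 79488 * (\<Sum>x\<in>cube n. (cmod (f x))\<^sup>2)"
  proof (rule multiplier_square_function_le)
    fix m
    have "(\<Sum>k<N. 1 / real (Suc k) * (E k m)\<^sup>2)
        \<le> (\<Sum>k<N. real (Suc k) * (E (Suc k) m - E k m)\<^sup>2 + (E k m)\<^sup>2 / real (Suc k))"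
      by (intro sum_mono) simp
    then show "(\<Sum>k<N. 1 / real (Suc k) * (E k m)\<^sup>2) \<le> 79488" using E2[of m] by simp
  qed auto
  have "(\<Sum>x\<in>cube n. \<Sum>k<N. increment_energy (\<lambda>k. multiplier n (E k) f x) k)
    = (\<Sum>x\<in>cube n. \<Sum>k<N. real (Suc k) * (cmod (multiplier n (\<lambda>m. E (Suc k) m - E k m) f x))\<^sup>2)
      + (\<Sum>x\<in>cube n. \<Sum>k<N. (1 / real (Suc k)) * (cmod (multiplier n (E k) f x))\<^sup>2)"
    by (simp add: increment_energy_def multiplier_diff sum.distrib)
  then show ?thesis using A B unfolding E_def N_def by simp
qed

lemma multiplier_contraction:
  assumes "\<And>m. m \<le> n \<Longrightarrow> (a m)\<^sup>2 \<le> 1"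
  shows "(\<Sum>x\<in>cube n. (cmod (multiplier n a f x))\<^sup>2) \<le> (\<Sum>x\<in>cube n. (cmod (f x))\<^sup>2)"
  using multiplier_square_function_le[of "{()}" "\<lambda>_. 1" n "\<lambda>_. a" 1 f] assms by simp

text \<open>The outer 16 comes from \<open>variation_le_add\<close>, the inner one from
  \<open>variation_le_energy\<close>.\<close>

definition half_range_const :: "real \<Rightarrow> real" where
  "half_range_const r = 16 * (16 * 158976 + lepingle_const r)"

lemma folded_variation:
  assumes r: "2 < r" and n: "1 \<le> n"
  obtains Y where "\<And>x. x \<in> cube n \<Longrightarrow> variation_le r (\<lambda>k. multiplier n (folded_eig n q k) f x) {..n div 2} (Y x)"
    and "(\<Sum>x\<in>cube n. Y x) \<le> half_range_const r * (\<Sum>x\<in>cube n. (cmod (f x))\<^sup>2)"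
proof -
  interpret symmetric_kernel "cube n" "flip_kernel n" by (rule symmetric_kernel_flip[OF n])
  define N where "N = n div 2"
  define g where "g = multiplier n (fold_sign n q) f"
  define h where "h k x = multiplier n (\<lambda>m. fold_sign n q m * eig_err n k (fold_freq n m)) f x" for k x
  have dec: "multiplier n (folded_eig n q k) f x = h k x + (markov ^^ (2 * k)) g x" if x: "x \<in> cube n" for k x
  proof -
    have "multiplier n (folded_eig n q k) f x - h k x
        = multiplier n (\<lambda>m. folded_eig n q k m - fold_sign n q m * eig_err n k (fold_freq n m)) f x"
      unfolding h_def by (rule multiplier_diff[symmetric])
    also have "\<dots> = multiplier n (\<lambda>m. (1 - 2 * real m / real n) ^ (2 * k) * fold_sign n q m) f x"
      by (rule multiplier_cong) (simp add: folded_eig_decompose[OF n])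
    also have "\<dots> = (markov ^^ (2 * k)) g x"
      unfolding markov_power_eq_multiplier[OF n x] g_def by (rule multiplier_multiplier[symmetric])
    finally show ?thesis by (simp only: diff_eq_eq add.commute)
  qed
  obtain Y where Y: "\<And>x. x \<in> cube n \<Longrightarrow> variation_le r (\<lambda>k. (markov ^^ (2 * k)) g x) {..N} (Y x)"
    and Ysum: "(\<Sum>x\<in>cube n. Y x) \<le> lepingle_const r * (\<Sum>x\<in>cube n. (cmod (g x))\<^sup>2)"
    by (rule markov_variation[OF r, where f = g and K = N], rule that)
  have L: "0 \<le> lepingle_const r"
  proof -
    have "(1 / 2 :: real) powr (r - 2) < 1"
      using r powr_less_mono2[of "r - 2" "1 / 2" 1] by simp
    then show ?thesis by (simp add: lepingle_const_def)
  qed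
  have gf: "(\<Sum>x\<in>cube n. (cmod (g x))\<^sup>2) \<le> (\<Sum>x\<in>cube n. (cmod (f x))\<^sup>2)"
    unfolding g_def by (rule multiplier_contraction) (simp add: fold_sign_sq)
  show thesis
  proof
    fix x assume x: "x \<in> cube n"
    have "variation_le r (\<lambda>k. h k x + (markov ^^ (2 * k)) g x) {..N}
        (16 * (16 * (\<Sum>k<N. increment_energy (\<lambda>k. h k x) k) + Y x))"
      using r by (intro variation_le_add variation_le_energy Y[OF x]) auto
    then show "variation_le r (\<lambda>k. multiplier n (folded_eig n q k) f x) {..n div 2}
        (16 * (16 * (\<Sum>k<N. increment_energy (\<lambda>k. h k x) k) + Y x))"
      by (simp only: dec[OF x] N_def)
  next
    have "(\<Sum>x\<in>cube n. 16 * (16 * (\<Sum>k<N. increment_energy (\<lambda>k. h k x) k) + Y x))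
        = 16 * (16 * (\<Sum>x\<in>cube n. \<Sum>k<N. increment_energy (\<lambda>k. h k x) k) + (\<Sum>x\<in>cube n. Y x))"
      by (simp add: sum.distrib flip: sum_distrib_left)
    also have "\<dots> \<le> 16 * (16 * (158976 * (\<Sum>x\<in>cube n. (cmod (f x))\<^sup>2))
        + lepingle_const r * (\<Sum>x\<in>cube n. (cmod (f x))\<^sup>2))"
      unfolding h_def N_def
      using Ysum mult_left_mono[OF gf L] by (intro mult_left_mono add_mono eig_err_energy[OF n]) auto
    finally show "(\<Sum>x\<in>cube n. 16 * (16 * (\<Sum>k<N. increment_energy (\<lambda>k. h k x) k) + Y x))
        \<le> half_range_const r * (\<Sum>x\<in>cube n. (cmod (f x))\<^sup>2)"
      by (simp add: half_range_const_def algebra_simps)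
  qed
qed

section \<open>Radii beyond \<open>n / 2\<close> and the full range\<close>

text \<open>On the frequency side, reflecting \<open>k\<close> multiplies the eigenvalue by
  \<open>(-1) ^ m\<close>, by duality in \<open>k\<close> and \<open>m\<close>; this sign is also
  the effect of the antipodal map on a Walsh function.\<close>

lemma spherical_mean_antipode:
  assumes x: "x \<in> cube n" and k: "k \<le> n"
  shows "spherical_mean n k f x = spherical_mean n (n - k) f (flip_bits n {1..n} x)"
proof -
  have "kraw_eig n k (card M) *\<^sub>R (walsh_coeff n f M * walsh M x)
      = kraw_eig n (n - k) (card M) *\<^sub>R (walsh_coeff n f M * walsh M (flip_bits n {1..n} x))"
    if M: "M \<subseteq> {1..n}" for M
  proof -
    have m: "card M \<le> n" using card_mono[OF _ M] by simp
    have "kraw_eig n (n - k) (card M) = (-1) ^ card M * kraw_eig n k (card M)"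
      using kraw_eig_sym[OF m, of "n - k"] kraw_eig_sym[OF m k] kraw_eig_reflect[OF k, of "card M"] by simp
    moreover have "{1..n} \<inter> M = M" using M by auto
    ultimately show ?thesis
      by (simp add: walsh_flip[OF x M] scaleR_conv_of_real flip: power_add)
  qed
  then show ?thesis
    unfolding spherical_mean_eq_multiplier[OF x] spherical_mean_eq_multiplier[OF flip_in_cube[OF x]] multiplier_def
    by (intro arg_cong2[where f = "(/)"] sum.cong) auto
qed

lemma sum_antipode: "(\<Sum>x\<in>cube n. g (flip_bits n {1..n} x)) = (\<Sum>x\<in>cube n. g x)"
proof -
  have "flip_bits n {1..n} (flip_bits n {1..n} x) = x" if x: "x \<in> cube n" for x
  proof (rule cube_ext[OF flip_in_cube[OF flip_in_cube[OF x]] x])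
    fix j assume j: "j \<in> {1..n}"
    then show "flip_bits n {1..n} (flip_bits n {1..n} x) j = x j" using cube_values[OF x j] by (auto simp: flip_bits_def)
  qed
  then show ?thesis
    by (intro sum.reindex_bij_witness[where i = "flip_bits n {1..n}" and j = "flip_bits n {1..n}"]) (auto simp: flip_in_cube)
qed

definition variation_const :: "real \<Rightarrow> real" where
  "variation_const r = 16 * (16 * (half_range_const r + half_range_const r) + 4)"

text \<open>The radii are cut at \<open>N = n div 2\<close>. Each half is the folded family with its
  index clamped at \<open>N\<close>, the upper one read at the antipode and backwards. A step
  function removes the constant value of the clamped half.\<close>

theorem spherical_variation:
  fixes n q :: nat and f :: "(nat \<Rightarrow> nat) \<Rightarrow> complex"
  assumes r: "2 < r" and n: "1 \<le> n"
  defines "Z \<equiv> {k \<in> {0..n}. k mod 2 = q mod 2}"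
  obtains Y where "\<And>x. x \<in> cube n \<Longrightarrow> variation_le r (\<lambda>k. spherical_mean n k f x) Z (Y x)"
    and "(\<Sum>x\<in>cube n. Y x) \<le> variation_const r * (\<Sum>x\<in>cube n. (cmod (f x))\<^sup>2)"
proof -
  define N where "N = n div 2"
  define L where "L q k = multiplier n (folded_eig n q k) f" for q k
  define F where "F = (\<Sum>x\<in>cube n. (cmod (f x))\<^sup>2)"
  let ?bar = "flip_bits n {1..n}"
  obtain Y1 where Y1: "\<And>x. x \<in> cube n \<Longrightarrow> variation_le r (\<lambda>k. L q k x) {..N} (Y1 x)"
    and Y1sum: "(\<Sum>x\<in>cube n. Y1 x) \<le> half_range_const r * F"
    by (rule folded_variation[OF r n, where q = q and f = f, folded L_def N_def F_def], rule that)
  \<comment> \<open>If \<open>k\<close> has the parity of \<open>q\<close>, then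
    \<open>n - k\<close> has the parity of \<open>n + q\<close>.\<close>
  obtain Y2 where Y2: "\<And>x. x \<in> cube n \<Longrightarrow> variation_le r (\<lambda>k. L (n + q) k x) {..N} (Y2 x)"
    and Y2sum: "(\<Sum>x\<in>cube n. Y2 x) \<le> half_range_const r * F"
    by (rule folded_variation[OF r n, where q = "n + q" and f = f, folded L_def N_def F_def], rule that)
  have mean: "spherical_mean n k f x = L q k x" if "x \<in> cube n" "k mod 2 = q mod 2" for q k x
    unfolding spherical_mean_eq_multiplier[OF that(1)] L_def
    by (rule multiplier_cong) (simp add: folded_eig_eq[OF that(2)])
  define c where "c x = - L (n + q) N (?bar x)" for x
  define d where "d x = - L q N x" for x
  define Y where "Y x = 16 * (16 * (Y1 x + Y2 (?bar x)) + (cmod (c x - d x))\<^sup>2)" for x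
  have dec: "L q (min k N) x + L (n + q) (min (n - k) N) (?bar x) + (if k \<le> N then c x else d x)
      = spherical_mean n k f x" if x: "x \<in> cube n" and k: "k \<in> Z" for x k
  proof (cases "k \<le> N")
    case True
    then have "min (n - k) N = N" "min k N = k" by (auto simp: N_def)
    then show ?thesis using True mean[OF x, of k q] k by (simp add: c_def Z_def)
  next
    case False
    have kn: "k \<le> n" "k mod 2 = q mod 2" using k by (auto simp: Z_def)
    have "even k = even q" using kn(2) by (simp add: even_iff_mod_2_eq_zero)
    then have "even (n - k) = even (n + q)" using kn(1) by simp
    then have "(n - k) mod 2 = (n + q) mod 2" by (simp only: mod2_eq_if)
    then have "spherical_mean n k f x = L (n + q) (n - k) (?bar x)"
      using spherical_mean_antipode[OF x kn(1)] mean[OF flip_in_cube[OF x], where q = "n + q" and k = "n - k"]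
      by simp
    moreover have "min (n - k) N = n - k" "min k N = N" using False by (auto simp: N_def)
    ultimately show ?thesis using False by (simp add: d_def)
  qed
  show thesis
  proof
    fix x assume x: "x \<in> cube n"
    have 1: "variation_le r (\<lambda>k. L q (min k N) x) Z (Y1 x)"
      by (rule variation_le_comp_mono[OF Y1[OF x]]) (auto simp: monotone_on_def)
    have 2: "variation_le r (\<lambda>k. L (n + q) (min (n - k) N) (?bar x)) Z (Y2 (?bar x))"
      by (rule variation_le_comp_antimono[OF Y2[OF flip_in_cube[OF x]]]) (auto simp: monotone_on_def)
    have "variation_le r (\<lambda>k. L q (min k N) x + L (n + q) (min (n - k) N) (?bar x) + (if k \<le> N then c x else d x)) Z (Y x)"
      unfolding Y_def using r by (intro variation_le_add variation_le_step 1 2) auto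
    then show "variation_le r (\<lambda>k. spherical_mean n k f x) Z (Y x)"
      by (rule variation_le_cong) (rule dec[OF x])
  next
    have LF: "(\<Sum>x\<in>cube n. (cmod (L q k x))\<^sup>2) \<le> F" for q k
      unfolding L_def F_def by (rule multiplier_contraction) (rule folded_eig_sq_le_1)
    have "(\<Sum>x\<in>cube n. (cmod (c x - d x))\<^sup>2)
        \<le> (\<Sum>x\<in>cube n. 2 * (cmod (L (n + q) N (?bar x)))\<^sup>2 + 2 * (cmod (L q N x))\<^sup>2)"
    proof (rule sum_mono)
      fix x
      have "cmod (c x - d x) \<le> cmod (L (n + q) N (?bar x)) + cmod (L q N x)"
        using norm_triangle_ineq4[of "c x" "d x"] by (simp add: c_def d_def)
      then have "(cmod (c x - d x))\<^sup>2 \<le> (cmod (L (n + q) N (?bar x)) + cmod (L q N x))\<^sup>2"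
        by (intro power_mono) auto
      also have "\<dots> \<le> 2 * (cmod (L (n + q) N (?bar x)))\<^sup>2 + 2 * (cmod (L q N x))\<^sup>2"
        using zero_le_power2[of "cmod (L (n + q) N (?bar x)) - cmod (L q N x)"]
        by (simp add: power2_eq_square algebra_simps)
      finally show "(cmod (c x - d x))\<^sup>2 \<le> 2 * (cmod (L (n + q) N (?bar x)))\<^sup>2 + 2 * (cmod (L q N x))\<^sup>2" .
    qed
    also have "\<dots> = 2 * (\<Sum>x\<in>cube n. (cmod (L (n + q) N x))\<^sup>2) + 2 * (\<Sum>x\<in>cube n. (cmod (L q N x))\<^sup>2)"
      using sum_antipode[of "\<lambda>x. (cmod (L (n + q) N x))\<^sup>2" n] by (simp add: sum.distrib flip: sum_distrib_left)
    also have "\<dots> \<le> 4 * F" using LF[of "n + q" N] LF[of q N] by simp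
    finally have cd: "(\<Sum>x\<in>cube n. (cmod (c x - d x))\<^sup>2) \<le> 4 * F" .
    have "(\<Sum>x\<in>cube n. Y x) = 16 * (16 * ((\<Sum>x\<in>cube n. Y1 x) + (\<Sum>x\<in>cube n. Y2 x)) + (\<Sum>x\<in>cube n. (cmod (c x - d x))\<^sup>2))"
      unfolding Y_def using sum_antipode[of Y2 n] by (simp only: sum.distrib flip: sum_distrib_left)
    also have "\<dots> \<le> 16 * (16 * (half_range_const r * F + half_range_const r * F) + 4 * F)"
      by (intro mult_left_mono add_mono Y1sum Y2sum cd) simp_all
    finally show "(\<Sum>x\<in>cube n. Y x) \<le> variation_const r * (\<Sum>x\<in>cube n. (cmod (f x))\<^sup>2)"
      by (simp add: variation_const_def F_def algebra_simps)
  qed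
qed

lemma cube_norm_variation_le:
  assumes r: "2 < r" and q: "q \<in> {0, 1}" and n: "1 \<le> n"
  shows "cube_norm n (\<lambda>x. variation r (\<lambda>k. spherical_mean n k f x) {k \<in> {0..n}. k mod 2 = q mod 2})
    \<le> sqrt (variation_const r) * cube_norm n f"
proof -
  let ?Z = "{k \<in> {0..n}. k mod 2 = q mod 2}"
  have Z: "finite ?Z" "?Z \<noteq> {}"
  proof -
    have "q \<in> ?Z" using q n by auto
    then show "?Z \<noteq> {}" by blast
  qed simp
  obtain Y where Y: "\<And>x. x \<in> cube n \<Longrightarrow> variation_le r (\<lambda>k. spherical_mean n k f x) ?Z (Y x)"
    and Ysum: "(\<Sum>x\<in>cube n. Y x) \<le> variation_const r * (\<Sum>x\<in>cube n. (cmod (f x))\<^sup>2)"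
    by (rule spherical_variation[OF r n, where q = q and f = f], rule that)
  have "(\<Sum>x\<in>cube n. (norm (variation r (\<lambda>k. spherical_mean n k f x) ?Z))\<^sup>2) \<le> (\<Sum>x\<in>cube n. Y x)"
    using variation_le_imp_variation[OF Y Z] r by (intro sum_mono) auto
  then have "(\<Sum>x\<in>cube n. (norm (variation r (\<lambda>k. spherical_mean n k f x) ?Z))\<^sup>2)
      \<le> variation_const r * (\<Sum>x\<in>cube n. (cmod (f x))\<^sup>2)" using Ysum by simp
  then show ?thesis
    unfolding cube_norm_def L2_set_def real_sqrt_mult[symmetric] by (rule real_sqrt_le_mono)
qed

text \<open>For \<open>w = 0\<close> the quotient is 0 by convention and the claim is
  \<open>0 \<le> c\<close>.\<close>

lemma divide_le_of_le_mult:
  fixes v w c :: real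
  shows "v \<le> c * w \<Longrightarrow> 0 \<le> w \<Longrightarrow> 0 \<le> c \<Longrightarrow> v / w \<le> c"
  by (cases "w = 0") (auto simp: divide_le_eq)

theorem theorem1p3:
  fixes r :: real and q :: nat
  assumes "r > 2" and "q \<in> {0, 1}"
  shows "(SUP n\<in>{1::nat..}. SUP f\<in>cube_functions n - {cube_zero n}.
            ereal (cube_norm n (\<lambda>x. variation r (\<lambda>k. spherical_mean n k f x)
                                        {k \<in> {0..n}. k mod 2 = q mod 2})
                   / cube_norm n f)) < \<infinity>"
proof -
  have "(SUP n\<in>{1::nat..}. SUP f\<in>cube_functions n - {cube_zero n}.
            ereal (cube_norm n (\<lambda>x. variation r (\<lambda>k. spherical_mean n k f x)
                                        {k \<in> {0..n}. k mod 2 = q mod 2})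
                   / cube_norm n f)) \<le> ereal \<bar>sqrt (variation_const r)\<bar>"
  proof (intro SUP_least)
    fix n :: nat and f assume "n \<in> {1..}"
    then have n: "1 \<le> n" by simp
    let ?V = "cube_norm n (\<lambda>x. variation r (\<lambda>k. spherical_mean n k f x) {k \<in> {0..n}. k mod 2 = q mod 2})"
    have f: "0 \<le> cube_norm n f" by (simp add: cube_norm_def)
    have "?V \<le> sqrt (variation_const r) * cube_norm n f"
      by (rule cube_norm_variation_le[OF assms n])
    also have "\<dots> \<le> \<bar>sqrt (variation_const r)\<bar> * cube_norm n f" using f by (intro mult_right_mono) auto
    finally have "?V \<le> \<bar>sqrt (variation_const r)\<bar> * cube_norm n f" .
    then have "?V / cube_norm n f \<le> \<bar>sqrt (variation_const r)\<bar>"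
      by (rule divide_le_of_le_mult[OF _ f abs_ge_zero])
    then show "ereal (?V / cube_norm n f) \<le> ereal \<bar>sqrt (variation_const r)\<bar>"
      by (rule ereal_less_eq(3)[THEN iffD2])
  qed
  also have "ereal \<bar>sqrt (variation_const r)\<bar> < \<infinity>" by (rule ereal_less_PInfty) simp
  finally show ?thesis .
qed

end
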